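(* Assume the semiparametric model $P(Y=1\mid X=x)=q(\beta^Tx)$ for some $\beta\in\mathbb{R}^{p_n}$ and some (unknown) function $q$, with $s=\operatorname{supp}\beta$, and that $X$ satisfies the linear regressions condition $$E(X\mid\beta^TX)=u_0+u\,\beta^TX$$ for some $u_0,u\in\mathbb{R}^{p_n}$ ($\beta,q,u_0,u$ may depend on $n$). Assume that $\beta^*\neq0$, i.e. that the coefficient $\eta$ in the collinearity relation $\beta^*=\eta\beta$ is non-zero. Assume further that $\rho(\cdot,y)$ is convex and Lipschitz with constant $L>0$ for each $y\in\{0,1\}$, that $X_{ij}\sim Subg(\sigma_{jn}^2)$, that $\beta^*$ exists and is unique, that $k_n\in\mathbb{N}_+$ is a deterministic sequence, and that: (a) for some constants $\vartheta,\delta,\varepsilon>0$ (not depending on $n$) and non-negative definite matrices $H=H_n\in\mathbb{R}^{p_n\times p_n}$: $R(b)-R(\beta^* )\ge\frac{\vartheta}{2}(b-\beta^* )^TH(b-\beta^* )$ for all $b$ with $b-\beta^*\in\mathcal{C}_\varepsilon\cap B_1(\delta)$; (b) for some constants $\epsilon,\theta>0$ (not depending on $n$) and every $w\subseteq\{1,\dots,p_n\}$ with $|w|\le k_n$: $R(b)-R(\beta^* )\ge\theta\|b-\beta^*\|_2^2$ for all $b\in\mathbb{R}^{p_n}$ with $\operatorname{supp}b\subseteq w$ and $\|b-\beta^*\|_2\le\epsilon$; (c) $|s^*|\le k_n$; (d) $P(\forall w\in\mathcal{M}_{SS}:|w|\le k_n)\to1$; (e) $\liminf_n\kappa_H(\varepsilon)>0$;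 (f) $\log(p_n\vee2)=o(n\lambda^2)$; (g) $k_n\lambda=o(\min\{\beta^*_{min},1\})$; (h) $k_n\log(p_n\vee2)=o(n)$; (i) $k_n\log(p_n\vee2)=o(a_n)$; (j) $a_nk_n=o(n\min\{\beta^*_{min},1\}^2)$. Then for the SS procedure $P(\hat s^*=s)\to1$ as $n\to\infty$.
   Context: For each $n$, $(X,Y)=(X^{(n)},Y^{(n)})$ is a random element of $\mathbb{R}^{p_n}\times\{0,1\}$ and $(X_i,Y_i)$, $i=1,\dots,n$, are iid copies of it, $X_i=(X_{i1},\dots,X_{ip_n})^T$; the index $n$ is suppressed, and $\beta^*,s^*,\beta^*_{min}$ may depend on $n$. A random variable $Z$ is $Subg(\sigma^2)$ if $E\exp(tZ)\le\exp(t^2\sigma^2/2)$ for all $t\in\mathbb{R}$. $s_n=\max_{1\le j\le p_n}\sigma_{jn}$. Standing assumptions: $\limsup_ns_n^2<\infty$; no nontrivial linear combination of the coordinates of $X$ is almost surely constant. For $\rho:\mathbb{R}\times\{0,1\}\to\mathbb{R}$ the risk and the empirical risk are $R(b)=E\rho(b^TX,Y)$ and $R_n(b)=\frac1n\sum_{i=1}^n\rho(b^TX_i,Y_i)$, $b\in\mathbb{R}^{p_n}$. $\beta^*=\arg\min_{b\in\mathbb{R}^{p_n}}R(b)$, $s^*=\operatorname{supp}\beta^*=\{i:\beta^*_i\ne0\}$, $s^{*c}=\{1,\dots,p_n\}\setminus s^*$, $\beta^*_{min}=\min_{i\in s^*}|\beta^*_i|$. $v_\pi$ denotes the restriction of $v$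 to the coordinates in $\pi$. $\mathcal{C}_\varepsilon=\{\Delta\in\mathbb{R}^{p_n}:\|\Delta_{s^{*c}}\|_1\le(3+\varepsilon)\|\Delta_{s^*}\|_1\}$, $B_1(r)=\{\Delta\in\mathbb{R}^{p_n}:\|\Delta\|_1\le r\}$, $\kappa_H(\varepsilon)=\inf_{\Delta\in\mathcal{C}_\varepsilon\setminus\{0\}}\frac{\Delta^TH\Delta}{\Delta^T\Delta}$. Infima and minima over the empty set are $+\infty$. $a\vee b=\max(a,b)$. For $w\subseteq\{1,\dots,p_n\}$, $\hat\beta(w)=\arg\min\{R_n(b):b\in\mathbb{R}^{p_n},\ \operatorname{supp}b\subseteq w\}$ and $GIC(w)=nR_n(\hat\beta(w))+a_n|w|$, where $a_n>0$ is a given (deterministic) penalty. SS (Screening and Selection) procedure, with deterministic $\lambda=\lambda_n>0$: (1) choose $\lambda$; (2) find $\hat\beta_L=\arg\min_{b\in\mathbb{R}^{p_n}}\{R_n(b)+\lambda\|b\|_1\}$; (3) write $\operatorname{supp}\hat\beta_L=\{j_1,\dots,j_k\}$ with $|\hat\beta_{L,j_1}|\ge\dots\ge|\hat\beta_{L,j_k}|>0$; (4) put $\mathcal{M}_{SS}=\{\emptyset,\{j_1\},\{j_1,j_2\},\dots,\{j_1,\dots,j_k\}\}$; (5) put $\hat s^*=\arg\min_{w\in\mathcal{M}_{SS}}GIC(w)$. Known fact used as background by the paper: under the semiparametric model and the linear regressions condition, $\beta^*=\eta\beta$ for some scalar $\eta$. *)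

theory Defs
  imports "HOL-Probability.Probability" "HOL-Library.Landau_Symbols"
begin

(* A deterministic vector in R^p is a function on nat that vanishes outside {1..p}, so that
   "supp b \<subseteq> {1..p}" says "b is in R^p" and the zero vector is "\<lambda>_. 0".  A random vector in R^p
   takes values in the product space "PiM {1..p} (\<lambda>_. borel)". *)

definition supp :: "(nat \<Rightarrow> real) \<Rightarrow> nat set" where
  "supp b = {j. b j \<noteq> 0}"

definition dotp :: "nat \<Rightarrow> (nat \<Rightarrow> real) \<Rightarrow> (nat \<Rightarrow> real) \<Rightarrow> real" where
  "dotp p b x = (\<Sum>j=1..p. b j * x j)"

definition quad :: "nat \<Rightarrow> (nat \<Rightarrow> nat \<Rightarrow> real) \<Rightarrow> (nat \<Rightarrow> real) \<Rightarrow> real" where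
  "quad p H v = (\<Sum>i=1..p. \<Sum>j=1..p. v i * H i j * v j)"

(* l1 norm of the restriction of v to the coordinates in A; for the l2 norm L2_set is used *)
definition l1 :: "(nat \<Rightarrow> real) \<Rightarrow> nat set \<Rightarrow> real" where
  "l1 v A = (\<Sum>j\<in>A. \<bar>v j\<bar>)"

definition cone_eps :: "nat \<Rightarrow> nat set \<Rightarrow> real \<Rightarrow> (nat \<Rightarrow> real) set" where
  "cone_eps p S e = {v. supp v \<subseteq> {1..p} \<and> l1 v ({1..p} - S) \<le> (3 + e) * l1 v S}"

definition l1_ball :: "nat \<Rightarrow> real \<Rightarrow> (nat \<Rightarrow> real) set" where
  "l1_ball p r = {v. supp v \<subseteq> {1..p} \<and> l1 v {1..p} \<le> r}"

(* extended real values, so that the infimum over the empty set is \<infinity> *)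
definition kappa :: "nat \<Rightarrow> (nat \<Rightarrow> nat \<Rightarrow> real) \<Rightarrow> nat set \<Rightarrow> real \<Rightarrow> ereal" where
  "kappa p H S e = (INF v \<in> cone_eps p S e - {\<lambda>_. 0}. ereal (quad p H v / dotp p v v))"

definition min_coef :: "(nat \<Rightarrow> real) \<Rightarrow> ereal" where
  "min_coef b = (INF j \<in> supp b. ereal \<bar>b j\<bar>)"

(* min {b_min, 1}, which is always finite *)
definition min_coef1 :: "(nat \<Rightarrow> real) \<Rightarrow> real" where
  "min_coef1 b = real_of_ereal (min (min_coef b) 1)"

(* Z is Subg(s2) for s2 = sigma^2; the nonnegative integral is used because the Bochner integral
   of a non-integrable function would be 0 *)
definition subg :: "'a measure \<Rightarrow> real \<Rightarrow> ('a \<Rightarrow> real) \<Rightarrow> bool" where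
  "subg M s2 Z \<longleftrightarrow> Z \<in> borel_measurable M \<and>
     (\<forall>t. (\<integral>\<^sup>+ \<omega>. ennreal (exp (t * Z \<omega>)) \<partial>M) \<le> ennreal (exp (t\<^sup>2 * s2 / 2)))"

definition obs_space :: "nat \<Rightarrow> ((nat \<Rightarrow> real) \<times> nat) measure" where
  "obs_space p = PiM {1..p} (\<lambda>_. borel) \<Otimes>\<^sub>M count_space {0, 1}"

definition iid_copies :: "'a measure \<Rightarrow> nat \<Rightarrow> nat \<Rightarrow> ('a \<Rightarrow> nat \<Rightarrow> real) \<Rightarrow> ('a \<Rightarrow> nat) \<Rightarrow>
    (nat \<Rightarrow> 'a \<Rightarrow> nat \<Rightarrow> real) \<Rightarrow> (nat \<Rightarrow> 'a \<Rightarrow> nat) \<Rightarrow> bool" where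
  "iid_copies M p n X Y Xs Ys \<longleftrightarrow>
     prob_space.indep_vars M (\<lambda>_. obs_space p) (\<lambda>i \<omega>. (Xs i \<omega>, Ys i \<omega>)) {1..n} \<and>
     (\<forall>i\<in>{1..n}. distr M (obs_space p) (\<lambda>\<omega>. (Xs i \<omega>, Ys i \<omega>))
                = distr M (obs_space p) (\<lambda>\<omega>. (X \<omega>, Y \<omega>)))"

definition semiparametric_model :: "'a measure \<Rightarrow> nat \<Rightarrow> ('a \<Rightarrow> nat \<Rightarrow> real) \<Rightarrow> ('a \<Rightarrow> nat) \<Rightarrow>
    (nat \<Rightarrow> real) \<Rightarrow> (real \<Rightarrow> real) \<Rightarrow> bool" where
  "semiparametric_model M p X Y b q \<longleftrightarrow>
     (AE \<omega> in M. real_cond_exp M (vimage_algebra (space M) X (PiM {1..p} (\<lambda>_. borel)))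
                    (\<lambda>\<omega>. of_bool (Y \<omega> = 1)) \<omega> = q (dotp p b (X \<omega>)))"

definition linear_regressions :: "'a measure \<Rightarrow> nat \<Rightarrow> ('a \<Rightarrow> nat \<Rightarrow> real) \<Rightarrow>
    (nat \<Rightarrow> real) \<Rightarrow> (nat \<Rightarrow> real) \<Rightarrow> (nat \<Rightarrow> real) \<Rightarrow> bool" where
  "linear_regressions M p X b u0 u \<longleftrightarrow>
     (\<forall>j\<in>{1..p}. AE \<omega> in M.
        real_cond_exp M (vimage_algebra (space M) (\<lambda>\<omega>. dotp p b (X \<omega>)) borel) (\<lambda>\<omega>. X \<omega> j) \<omega>
          = u0 j + u j * dotp p b (X \<omega>))"

definition risk :: "(real \<Rightarrow> nat \<Rightarrow> real) \<Rightarrow> 'a measure \<Rightarrow> nat \<Rightarrow> ('a \<Rightarrow> nat \<Rightarrow> real) \<Rightarrow> ('a \<Rightarrow> nat) \<Rightarrow>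
    (nat \<Rightarrow> real) \<Rightarrow> real" where
  "risk \<rho> M p X Y b = (\<integral>\<omega>. \<rho> (dotp p b (X \<omega>)) (Y \<omega>) \<partial>M)"

definition emp_risk :: "(real \<Rightarrow> nat \<Rightarrow> real) \<Rightarrow> nat \<Rightarrow> nat \<Rightarrow> (nat \<Rightarrow> nat \<Rightarrow> real) \<Rightarrow> (nat \<Rightarrow> nat) \<Rightarrow>
    (nat \<Rightarrow> real) \<Rightarrow> real" where
  "emp_risk \<rho> p n xs ys b = (1 / real n) * (\<Sum>i=1..n. \<rho> (dotp p b (xs i)) (ys i))"

(* x is a value of "arg min {f y. P y}".  Empirical minimizers need not exist for every sample
   (for instance with logistic loss and separated data) and need not be unique; x is any minimizer
   if there is one, and otherwise any feasible point. *)
definition arg_min_choice :: "('b \<Rightarrow> real) \<Rightarrow> ('b \<Rightarrow> bool) \<Rightarrow> 'b \<Rightarrow> bool" where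
  "arg_min_choice f P x \<longleftrightarrow> P x \<and> ((\<exists>y. is_arg_min f P y) \<longrightarrow> is_arg_min f P x)"

definition gic :: "(real \<Rightarrow> nat \<Rightarrow> real) \<Rightarrow> nat \<Rightarrow> nat \<Rightarrow> (nat \<Rightarrow> nat \<Rightarrow> real) \<Rightarrow> (nat \<Rightarrow> nat) \<Rightarrow>
    real \<Rightarrow> (nat set \<Rightarrow> nat \<Rightarrow> real) \<Rightarrow> nat set \<Rightarrow> real" where
  "gic \<rho> p n xs ys a bhat w = real n * emp_risk \<rho> p n xs ys (bhat w) + a * real (card w)"

(* js enumerates supp b by decreasing absolute value, ties being broken arbitrarily *)
definition ordered_supp :: "(nat \<Rightarrow> real) \<Rightarrow> nat list \<Rightarrow> bool" where
  "ordered_supp b js \<longleftrightarrow>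
     distinct js \<and> set js = supp b \<and> sorted_wrt (\<lambda>i j. \<bar>b i\<bar> \<ge> \<bar>b j\<bar>) js"

definition ss_models :: "nat list \<Rightarrow> nat set set" where
  "ss_models js = (\<lambda>m. set (take m js)) ` {0..length js}"

(* One run of the screening and selection procedure on the sample (xs, ys): bL is the Lasso
   estimator, js the ordering of its support, bhat w the minimizer of the empirical risk over the
   model w, and shat the selected model. *)
definition ss_run :: "(real \<Rightarrow> nat \<Rightarrow> real) \<Rightarrow> nat \<Rightarrow> nat \<Rightarrow> (nat \<Rightarrow> nat \<Rightarrow> real) \<Rightarrow> (nat \<Rightarrow> nat) \<Rightarrow>
    real \<Rightarrow> real \<Rightarrow> (nat \<Rightarrow> real) \<Rightarrow> nat list \<Rightarrow> (nat set \<Rightarrow> nat \<Rightarrow> real) \<Rightarrow> nat set \<Rightarrow> bool" where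
  "ss_run \<rho> p n xs ys lam a bL js bhat shat \<longleftrightarrow>
     arg_min_choice (\<lambda>b. emp_risk \<rho> p n xs ys b + lam * l1 b {1..p}) (\<lambda>b. supp b \<subseteq> {1..p}) bL \<and>
     ordered_supp bL js \<and>
     (\<forall>w. w \<subseteq> {1..p} \<longrightarrow> arg_min_choice (emp_risk \<rho> p n xs ys) (\<lambda>b. supp b \<subseteq> w) (bhat w)) \<and>
     is_arg_min (gic \<rho> p n xs ys a bhat) (\<lambda>w. w \<in> ss_models js) shat"

end

theory Submission
  imports Defs
begin

text \<open>
  Subgaussian variables are centered, so the linear regressions have no intercept; Jensen's
  inequality given \<open>\<beta>\<^sup>TX\<close> then shows that projecting \<open>\<beta>\<^sup>*\<close> onto the line spanned by \<open>\<beta>\<close> does not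
  increase the risk. By uniqueness \<open>\<beta>\<^sup>* = \<eta>\<beta>\<close> with \<open>\<eta> \<noteq> 0\<close>, and both vectors have the same support \<open>s\<close>.

  Replacing the summands one at a time, symmetrization and contraction for the exponential function
  reduce the increments of \<open>R\<^sub>n - R\<close> at \<open>\<beta>\<^sup>*\<close> over an \<open>\<ell>\<^sub>1\<close> ball of radius \<open>r\<close> to \<open>r\<close> times a maximum of
  \<open>p\<close> subgaussian sums. Hence these increments exceed \<open>c\<close> with probability at most
  \<open>4p exp(- n c\<^sup>2 / (32 L\<^sup>2 r\<^sup>2 \<sigma>\<^sup>2))\<close>. This is used at three scales: radius of order \<open>k\<lambda>\<close> for the Lasso,
  which then orders \<open>s\<close> before its complement, and \<open>\<ell>\<^sub>2\<close> radii \<open>sqrt (a / (n\<theta>))\<close> and of order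
  the smallest nonzero coefficient of \<open>\<beta>\<^sup>*\<close>, for the models of the path that contain \<open>s\<close> and for
  those strictly contained in \<open>s\<close>.
  On a sphere around \<open>\<beta>\<^sup>*\<close> the curvature of the risk beats the deviation, and convexity carries
  the inequality to the outside. Thus the minimizers exist and lie inside the sphere.
\<close>

section \<open>Symmetrization and contraction for exponential moments\<close>

text \<open>The pair \<open>(x, y)\<close> is weakly majorized by \<open>(p, q)\<close>, and
  \<open>exp\<close> is convex and increasing. After sorting, if \<open>q \<le> x\<close>, the
  product of \<open>exp p - exp x\<close> and \<open>1 - exp (q - x)\<close> is nonnegative; this
  compares \<open>(x, p + q - x)\<close> with \<open>(p, q)\<close>, and monotonicity lowers
  \<open>p + q - x\<close> to \<open>y\<close>. If \<open>x < q\<close>, the comparison is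
  termwise.\<close>

lemma exp_submajorization:
  fixes x y p q :: real
  assumes "x \<le> max p q" "y \<le> max p q" "x + y \<le> p + q"
  shows "exp x + exp y \<le> exp p + exp q"
proof -
  have core: "exp x + exp y \<le> exp p + exp q"
    if "y \<le> x" "q \<le> p" "x \<le> p" "x + y \<le> p + q" for x y p q :: real
  proof (cases "q \<le> x")
    case True
    have "0 \<le> (exp p - exp x) * (1 - exp (q - x))"
      using that True by (intro mult_nonneg_nonneg) auto
    also have "\<dots> = exp p + exp q - exp x - exp (p + q - x)"
      by (simp add: algebra_simps flip: exp_add)
    finally have "exp x + exp (p + q - x) \<le> exp p + exp q" by simp
    moreover have "exp y \<le> exp (p + q - x)" using that by simp
    ultimately show ?thesis by linarith
  next
    case False
    have "exp x \<le> exp p" "exp y \<le> exp q" using that False by auto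
    then show ?thesis by linarith
  qed
  show ?thesis
    using core[of y x q p] core[of x y q p] core[of y x p q] core[of x y p q] assms
    by (cases "y \<le> x"; cases "q \<le> p") (auto simp: max_def add.commute)
qed

text \<open>One sign of the Ledoux-Talagrand contraction principle. For indices \<open>t\<close> and
  \<open>s\<close>, the exponents \<open>A t + \<phi> t\<close> and \<open>A s - \<phi> s\<close>
  are weakly majorized by the larger of the two \<open>A + x\<close> and the larger of the two
  \<open>A - x\<close>: \<open>bound\<close> controls each exponent, \<open>lip\<close> their sum.
  Since \<open>t\<close> and \<open>s\<close> vary independently, the two suprema can be taken
  separately.\<close>

lemma exp_contraction:
  fixes A \<phi> x :: "'t \<Rightarrow> real"
  assumes T: "T \<noteq> {}"
    and bound: "\<And>t. t \<in> T \<Longrightarrow> \<bar>\<phi> t\<bar> \<le> \<bar>x t\<bar>"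
    and lip: "\<And>s t. s \<in> T \<Longrightarrow> t \<in> T \<Longrightarrow> \<bar>\<phi> s - \<phi> t\<bar> \<le> \<bar>x s - x t\<bar>"
  shows "(SUP t\<in>T. ennreal (exp (A t + \<phi> t))) + (SUP t\<in>T. ennreal (exp (A t - \<phi> t)))
       \<le> (SUP t\<in>T. ennreal (exp (A t + x t))) + (SUP t\<in>T. ennreal (exp (A t - x t)))"
    (is "_ \<le> ?P + ?N")
proof -
  have pair: "ennreal (exp (A t + \<phi> t)) + ennreal (exp (A s - \<phi> s)) \<le> ?P + ?N"
    if "t \<in> T" "s \<in> T" for t s
  proof -
    let ?p = "max (A t + x t) (A s + x s)" and ?q = "max (A t - x t) (A s - x s)"
    have "exp (A t + \<phi> t) + exp (A s - \<phi> s) \<le> exp ?p + exp ?q"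
      using bound[of t] bound[of s] lip[of t s] that
      by (intro exp_submajorization) (auto simp: max_def abs_real_def split: if_splits)
    then have "ennreal (exp (A t + \<phi> t) + exp (A s - \<phi> s)) \<le> ennreal (exp ?p + exp ?q)"
      by (rule ennreal_leI)
    then have "ennreal (exp (A t + \<phi> t)) + ennreal (exp (A s - \<phi> s)) \<le> ennreal (exp ?p) + ennreal (exp ?q)"
      by simp
    also have "ennreal (exp ?p) \<le> ?P"
      using that by (auto simp: max_def intro: SUP_upper)
    also have "ennreal (exp ?q) \<le> ?N"
      using that by (auto simp: max_def intro: SUP_upper)
    finally show ?thesis by (simp add: add_mono)
  qed
  have "ennreal (exp (A t + \<phi> t)) + (SUP s\<in>T. ennreal (exp (A s - \<phi> s))) \<le> ?P + ?N" if "t \<in> T" for t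
    using pair[OF that] by (subst ennreal_SUP_add_right[OF T]) (auto intro: SUP_least)
  then show ?thesis
    by (subst ennreal_SUP_add_left[OF T, symmetric]) (auto intro: SUP_least)
qed

text \<open>Integrates the tangent line of \<open>exp\<close> at the mean of \<open>a - f\<close>.
  Integrability of the exponential comes from finiteness of the right-hand side; if that is
  infinite, nothing is to be shown.\<close>

lemma (in prob_space) ennreal_exp_jensen:
  fixes f :: "'a \<Rightarrow> real"
  assumes f: "integrable M f"
  shows "ennreal (exp (a - (\<integral>z. f z \<partial>M))) \<le> (\<integral>\<^sup>+ z. ennreal (exp (a - f z)) \<partial>M)"
proof (cases "(\<integral>\<^sup>+ z. ennreal (exp (a - f z)) \<partial>M) = \<infinity>")
  case False
  have [measurable]: "f \<in> borel_measurable M" using f by auto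
  let ?m = "a - (\<integral>z. f z \<partial>M)"
  have fin: "integrable M (\<lambda>z. exp (a - f z))"
    using False by (intro integrableI_bounded) (auto simp: less_top)
  have "exp ?m = (\<integral>z. exp ?m * (1 + ((a - f z) - ?m)) \<partial>M)"
    using f by (simp add: prob_space)
  also have "\<dots> \<le> (\<integral>z. exp (a - f z) \<partial>M)"
  proof (rule integral_mono)
    fix z
    have "exp ?m * (1 + ((a - f z) - ?m)) \<le> exp ?m * exp ((a - f z) - ?m)"
      by (intro mult_left_mono exp_ge_add_one_self) auto
    also have "\<dots> = exp (a - f z)" by (simp flip: exp_add)
    finally show "exp ?m * (1 + ((a - f z) - ?m)) \<le> exp (a - f z)" .
  qed (use f fin in auto)
  finally show ?thesis using fin by (simp add: nn_integral_eq_integral ennreal_leI)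
qed simp

text \<open>Jensen's inequality replaces the mean by an independent copy \<open>z'\<close>. The
  arithmetic-geometric mean inequality then bounds the exponential of
  \<open>A t + f t z - f t z'\<close> by half the sum of those of \<open>A t + 2 * f t z\<close> and
  \<open>A t - 2 * f t z'\<close>. This decouples the copies at the price of a factor 2, and what
  remains is an average over a fair sign.\<close>

lemma (in prob_space) exp_symmetrization:
  fixes f :: "'t \<Rightarrow> 'a \<Rightarrow> real"
  assumes T: "countable T" "T \<noteq> {}" and f: "\<And>t. t \<in> T \<Longrightarrow> integrable M (f t)"
  shows "(\<integral>\<^sup>+ z. (SUP t\<in>T. ennreal (exp (A t + (f t z - (\<integral>z. f t z \<partial>M))))) \<partial>M)
    \<le> (\<integral>\<^sup>+ z. ((SUP t\<in>T. ennreal (exp (A t + 2 * f t z))) + (SUP t\<in>T. ennreal (exp (A t - 2 * f t z)))) / 2 \<partial>M)"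
proof -
  have [measurable]: "f t \<in> borel_measurable M" if "t \<in> T" for t using f[OF that] by auto
  let ?P = "\<lambda>z. (SUP t\<in>T. ennreal (exp (A t + 2 * f t z)))"
  let ?N = "\<lambda>z. (SUP t\<in>T. ennreal (exp (A t - 2 * f t z)))"
  note [measurable] = T(1)
  have PN[measurable]: "?P \<in> borel_measurable M" "?N \<in> borel_measurable M" by measurable
  have half: "ennreal (exp (A t + f t z - f t z')) \<le> ?P z / 2 + ?N z' / 2" if t: "t \<in> T" for t z z'
  proof -
    let ?a = "A t + 2 * f t z" and ?b = "A t - 2 * f t z'"
    have "exp (A t + f t z - f t z') = exp (?a / 2) * exp (?b / 2)"
      by (simp add: field_simps flip: exp_add)
    also have "\<dots> \<le> ((exp (?a / 2))\<^sup>2 + (exp (?b / 2))\<^sup>2) / 2"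
      using sum_squares_bound[of "exp (?a / 2)" "exp (?b / 2)"] by (simp add: field_simps)
    also have "\<dots> = exp ?a / 2 + exp ?b / 2"
      by (simp add: add_divide_distrib flip: exp_double)
    finally have "ennreal (exp (A t + f t z - f t z')) \<le> ennreal (exp ?a / 2 + exp ?b / 2)"
      by (rule ennreal_leI)
    also have "\<dots> = ennreal (exp ?a) / 2 + ennreal (exp ?b) / 2"
      by (simp add: ennreal_plus divide_ennreal flip: ennreal_numeral)
    also have "\<dots> \<le> ?P z / 2 + ?N z' / 2"
      using t by (intro add_mono divide_right_mono_ennreal SUP_upper2[of t]) auto
    finally show ?thesis .
  qed
  have "(\<integral>\<^sup>+ z. (SUP t\<in>T. ennreal (exp (A t + (f t z - (\<integral>z. f t z \<partial>M))))) \<partial>M)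
      \<le> (\<integral>\<^sup>+ z. (\<integral>\<^sup>+ z'. ?P z / 2 + ?N z' / 2 \<partial>M) \<partial>M)"
  proof (intro nn_integral_mono SUP_least)
    fix z t assume t: "t \<in> T"
    have "ennreal (exp (A t + (f t z - (\<integral>z. f t z \<partial>M)))) \<le> (\<integral>\<^sup>+ z'. ennreal (exp ((A t + f t z) - f t z')) \<partial>M)"
      using ennreal_exp_jensen[OF f[OF t], of "A t + f t z"] by (simp add: algebra_simps)
    also have "\<dots> \<le> (\<integral>\<^sup>+ z'. ?P z / 2 + ?N z' / 2 \<partial>M)"
      using half[OF t] by (intro nn_integral_mono) auto
    finally show "ennreal (exp (A t + (f t z - (\<integral>z. f t z \<partial>M)))) \<le> (\<integral>\<^sup>+ z'. ?P z / 2 + ?N z' / 2 \<partial>M)" .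
  qed
  also have "\<dots> = (\<integral>\<^sup>+ z. ?P z / 2 \<partial>M) + (\<integral>\<^sup>+ z. ?N z / 2 \<partial>M)"
    by (simp add: nn_integral_add emeasure_space_1)
  also have "\<dots> = (\<integral>\<^sup>+ z. (?P z + ?N z) / 2 \<partial>M)"
    by (simp add: add_divide_distrib_ennreal nn_integral_add)
  finally show ?thesis .
qed

abbreviation coin :: "bool measure" where
  "coin \<equiv> measure_pmf (bernoulli_pmf (1 / 2))"

abbreviation coin_sign :: "bool \<Rightarrow> real" where
  "coin_sign e \<equiv> (if e then 1 else - 1)"

lemma nn_integral_pair_coin:
  assumes [measurable]: "G \<in> borel_measurable (D \<Otimes>\<^sub>M coin)"
  shows "(\<integral>\<^sup>+ q. G q \<partial>(D \<Otimes>\<^sub>M coin)) = (\<integral>\<^sup>+ z. (G (z, True) + G (z, False)) / 2 \<partial>D)"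
proof -
  have "(\<integral>\<^sup>+ q. G q \<partial>(D \<Otimes>\<^sub>M coin)) = (\<integral>\<^sup>+ z. \<integral>\<^sup>+ e. G (z, e) \<partial>coin \<partial>D)"
    by (rule measure_pmf.nn_integral_fst[symmetric]) simp
  also have "\<dots> = (\<integral>\<^sup>+ z. (G (z, True) + G (z, False)) / 2 \<partial>D)"
  proof (intro nn_integral_cong)
    fix z
    have half: "ennreal (1 / 2) = inverse 2"
      using inverse_ennreal[of 2] by (simp add: inverse_eq_divide)
    show "(\<integral>\<^sup>+ e. G (z, e) \<partial>coin) = (G (z, True) + G (z, False)) / 2"
      by (subst nn_integral_bernoulli_pmf) (simp_all add: divide_ennreal_def distrib_right flip: half)
  qed
  finally show ?thesis .
qed

text \<open>For fixed \<open>z\<close>, symmetrization leaves exactly the sum of two suprema to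
  which contraction applies. The half-sum is then written as an integral over an additional coin, so
  that the bound is again an integral over a product space.\<close>

lemma (in prob_space) exp_symmetrized_contraction:
  fixes f x :: "'t \<Rightarrow> 'a \<Rightarrow> real"
  assumes T: "countable T" "T \<noteq> {}" and f: "\<And>t. t \<in> T \<Longrightarrow> integrable M (f t)"
    and x[measurable]: "\<And>t. t \<in> T \<Longrightarrow> x t \<in> borel_measurable M"
    and bound: "\<And>t z. t \<in> T \<Longrightarrow> z \<in> space M \<Longrightarrow> \<bar>f t z\<bar> \<le> \<bar>x t z\<bar>"
    and lip: "\<And>s t z. s \<in> T \<Longrightarrow> t \<in> T \<Longrightarrow> z \<in> space M \<Longrightarrow> \<bar>f s z - f t z\<bar> \<le> \<bar>x s z - x t z\<bar>"
  shows "(\<integral>\<^sup>+ z. (SUP t\<in>T. ennreal (exp (A t + (f t z - (\<integral>z. f t z \<partial>M))))) \<partial>M)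
    \<le> (\<integral>\<^sup>+ q. (SUP t\<in>T. ennreal (exp (A t + coin_sign (snd q) * (2 * x t (fst q))))) \<partial>(M \<Otimes>\<^sub>M coin))"
proof -
  note [measurable] = T(1)
  have "(\<integral>\<^sup>+ z. (SUP t\<in>T. ennreal (exp (A t + (f t z - (\<integral>z. f t z \<partial>M))))) \<partial>M)
    \<le> (\<integral>\<^sup>+ z. ((SUP t\<in>T. ennreal (exp (A t + 2 * f t z))) + (SUP t\<in>T. ennreal (exp (A t - 2 * f t z)))) / 2 \<partial>M)"
    using exp_symmetrization[OF T f] .
  also have "\<dots> \<le> (\<integral>\<^sup>+ z. ((SUP t\<in>T. ennreal (exp (A t + 2 * x t z))) + (SUP t\<in>T. ennreal (exp (A t - 2 * x t z)))) / 2 \<partial>M)"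
  proof (intro nn_integral_mono divide_right_mono_ennreal exp_contraction T(2))
    fix z t assume "z \<in> space M" "t \<in> T"
    then show "\<bar>2 * f t z\<bar> \<le> \<bar>2 * x t z\<bar>" using bound[of t z] by linarith
  next
    fix z s t assume "z \<in> space M" "s \<in> T" "t \<in> T"
    then show "\<bar>2 * f s z - 2 * f t z\<bar> \<le> \<bar>2 * x s z - 2 * x t z\<bar>" using lip[of s t z] by linarith
  qed
  also have "\<dots> = (\<integral>\<^sup>+ q. (SUP t\<in>T. ennreal (exp (A t + coin_sign (snd q) * (2 * x t (fst q))))) \<partial>(M \<Otimes>\<^sub>M coin))"
    by (subst nn_integral_pair_coin) simp_all
  finally show ?thesis .
qed

text \<open>Replaces the summands one at a time. Because \<open>one\<close> holds for every offset
  \<open>A\<close>, the summands that are not being replaced can be absorbed into the offset, which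
  may depend on \<open>t\<close> in any way.\<close>

lemma nn_integral_SUP_exp_PiM_mono:
  fixes g :: "'t \<Rightarrow> 'b \<Rightarrow> real" and h :: "'t \<Rightarrow> 'c \<Rightarrow> real"
  assumes D: "prob_space D" and Q: "prob_space Q" and T[measurable]: "countable T"
    and g[measurable]: "\<And>t. t \<in> T \<Longrightarrow> g t \<in> borel_measurable D"
    and h[measurable]: "\<And>t. t \<in> T \<Longrightarrow> h t \<in> borel_measurable Q"
    and one: "\<And>A. (\<integral>\<^sup>+ z. (SUP t\<in>T. ennreal (exp (A t + g t z))) \<partial>D)
                 \<le> (\<integral>\<^sup>+ q. (SUP t\<in>T. ennreal (exp (A t + h t q))) \<partial>Q)"
    and I: "finite I"
  shows "(\<integral>\<^sup>+ z. (SUP t\<in>T. ennreal (exp (A t + (\<Sum>i\<in>I. g t (z i))))) \<partial>(PiM I (\<lambda>_. D)))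
       \<le> (\<integral>\<^sup>+ q. (SUP t\<in>T. ennreal (exp (A t + (\<Sum>i\<in>I. h t (q i))))) \<partial>(PiM I (\<lambda>_. Q)))"
  using I
proof (induction I arbitrary: A)
  case empty
  show ?case by (simp add: PiM_empty nn_integral_count_space_finite)
next
  case (insert i I)
  interpret D: product_prob_space "\<lambda>_. D" by (intro product_prob_spaceI D)
  interpret Q: product_prob_space "\<lambda>_. Q" by (intro product_prob_spaceI Q)
  interpret QI: prob_space "PiM I (\<lambda>_. Q)" by (intro prob_space_PiM Q)
  interpret D1: prob_space D by fact
  interpret P: pair_sigma_finite "PiM I (\<lambda>_. Q)" D ..
  have split: "(\<Sum>j\<in>insert i I. f ((z(i := y)) j)) = f y + (\<Sum>j\<in>I. f (z j))"
    for f :: "'x \<Rightarrow> real" and z y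
  proof -
    have "(\<Sum>j\<in>I. f ((z(i := y)) j)) = (\<Sum>j\<in>I. f (z j))"
      using insert.hyps by (intro sum.cong) auto
    then show ?thesis using insert.hyps by simp
  qed
  have "(\<integral>\<^sup>+ z. (SUP t\<in>T. ennreal (exp (A t + (\<Sum>j\<in>insert i I. g t (z j))))) \<partial>(PiM (insert i I) (\<lambda>_. D)))
      = (\<integral>\<^sup>+ y. (\<integral>\<^sup>+ z. (SUP t\<in>T. ennreal (exp (A t + (\<Sum>j\<in>insert i I. g t ((z(i := y)) j))))) \<partial>(PiM I (\<lambda>_. D))) \<partial>D)"
    by (rule D.product_nn_integral_insert_rev[OF insert.hyps(1,2)]) measurable
  also have "\<dots> = (\<integral>\<^sup>+ y. (\<integral>\<^sup>+ z. (SUP t\<in>T. ennreal (exp ((A t + g t y) + (\<Sum>j\<in>I. g t (z j))))) \<partial>(PiM I (\<lambda>_. D))) \<partial>D)"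
    by (simp only: split add.assoc)
  also have "\<dots> \<le> (\<integral>\<^sup>+ y. (\<integral>\<^sup>+ q. (SUP t\<in>T. ennreal (exp ((A t + g t y) + (\<Sum>j\<in>I. h t (q j))))) \<partial>(PiM I (\<lambda>_. Q))) \<partial>D)"
    by (intro nn_integral_mono insert.IH)
  \<comment> \<open>The coordinate still to be replaced is moved into the inner integral, so that
    the already replaced ones are fixed and act as an offset.\<close>
  also have "\<dots> = (\<integral>\<^sup>+ q. (\<integral>\<^sup>+ y. (SUP t\<in>T. ennreal (exp ((A t + g t y) + (\<Sum>j\<in>I. h t (q j))))) \<partial>D) \<partial>(PiM I (\<lambda>_. Q)))"
    by (rule P.Fubini') measurable
  also have "\<dots> = (\<integral>\<^sup>+ q. (\<integral>\<^sup>+ y. (SUP t\<in>T. ennreal (exp ((A t + (\<Sum>j\<in>I. h t (q j))) + g t y))) \<partial>D) \<partial>(PiM I (\<lambda>_. Q)))"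
    by (simp only: ac_simps)
  also have "\<dots> \<le> (\<integral>\<^sup>+ q. (\<integral>\<^sup>+ y. (SUP t\<in>T. ennreal (exp ((A t + (\<Sum>j\<in>I. h t (q j))) + h t y))) \<partial>Q) \<partial>(PiM I (\<lambda>_. Q)))"
    by (intro nn_integral_mono one)
  also have "\<dots> = (\<integral>\<^sup>+ q. (\<integral>\<^sup>+ y. (SUP t\<in>T. ennreal (exp (A t + (\<Sum>j\<in>insert i I. h t ((q(i := y)) j))))) \<partial>Q) \<partial>(PiM I (\<lambda>_. Q)))"
    by (simp only: split ac_simps)
  also have "\<dots> = (\<integral>\<^sup>+ q. (SUP t\<in>T. ennreal (exp (A t + (\<Sum>j\<in>insert i I. h t (q j))))) \<partial>(PiM (insert i I) (\<lambda>_. Q)))"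
    by (rule Q.product_nn_integral_insert[OF insert.hyps(1,2), symmetric]) measurable
  finally show ?case .
qed

text \<open>A fair sign averages the exponential moments at \<open>c\<close> and \<open>- c\<close>,
  which obey the same bound; the product measure multiplies the bounds of the coordinates.\<close>

lemma nn_integral_sign_sum_le:
  assumes M: "prob_space M" and y: "subg M s2 y" and I: "finite I"
  shows "(\<integral>\<^sup>+ q. ennreal (exp (c * (\<Sum>i\<in>I. coin_sign (snd (q i)) * y (fst (q i))))) \<partial>(PiM I (\<lambda>_. M \<Otimes>\<^sub>M coin)))
     \<le> ennreal (exp (real (card I) * (c\<^sup>2 * s2 / 2)))"
proof -
  interpret M: prob_space M by fact
  interpret MC: pair_prob_space M coin by unfold_locales
  interpret P: product_prob_space "\<lambda>_. M \<Otimes>\<^sub>M coin" by (intro product_prob_spaceI) unfold_locales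
  have [measurable]: "y \<in> borel_measurable M"
    and mgf: "(\<integral>\<^sup>+ z. ennreal (exp (t * y z)) \<partial>M) \<le> ennreal (exp (t\<^sup>2 * s2 / 2))" for t
    using y by (auto simp: subg_def)
  have one: "(\<integral>\<^sup>+ q. ennreal (exp (c * (coin_sign (snd q) * y (fst q)))) \<partial>(M \<Otimes>\<^sub>M coin)) \<le> ennreal (exp (c\<^sup>2 * s2 / 2))"
  proof -
    have "(\<integral>\<^sup>+ q. ennreal (exp (c * (coin_sign (snd q) * y (fst q)))) \<partial>(M \<Otimes>\<^sub>M coin))
        = (\<integral>\<^sup>+ z. (ennreal (exp (c * y z)) + ennreal (exp (- c * y z))) / 2 \<partial>M)"
      by (subst nn_integral_pair_coin) simp_all
    also have "\<dots> = ((\<integral>\<^sup>+ z. ennreal (exp (c * y z)) \<partial>M) + (\<integral>\<^sup>+ z. ennreal (exp (- c * y z)) \<partial>M)) / 2"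
      by (simp add: nn_integral_divide nn_integral_add)
    also have "\<dots> \<le> (ennreal (exp (c\<^sup>2 * s2 / 2)) + ennreal (exp (c\<^sup>2 * s2 / 2))) / 2"
      using mgf[of c] mgf[of "- c"] by (intro divide_right_mono_ennreal add_mono) auto
    also have "\<dots> = ennreal (exp (c\<^sup>2 * s2 / 2))"
      by (simp add: ennreal_divide_numeral flip: ennreal_plus)
    finally show ?thesis .
  qed
  have "(\<integral>\<^sup>+ q. ennreal (exp (c * (\<Sum>i\<in>I. coin_sign (snd (q i)) * y (fst (q i))))) \<partial>(PiM I (\<lambda>_. M \<Otimes>\<^sub>M coin)))
      = (\<integral>\<^sup>+ q. (\<Prod>i\<in>I. ennreal (exp (c * (coin_sign (snd (q i)) * y (fst (q i)))))) \<partial>(PiM I (\<lambda>_. M \<Otimes>\<^sub>M coin)))"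
    using I by (simp only: sum_distrib_left exp_sum prod_ennreal[OF exp_ge_zero])
  also have "\<dots> = (\<Prod>i\<in>I. (\<integral>\<^sup>+ q. ennreal (exp (c * (coin_sign (snd q) * y (fst q)))) \<partial>(M \<Otimes>\<^sub>M coin)))"
    by (rule P.product_nn_integral_prod[OF I]) measurable
  also have "\<dots> \<le> (\<Prod>i\<in>I. ennreal (exp (c\<^sup>2 * s2 / 2)))"
    by (intro prod_mono_ennreal one)
  also have "\<dots> = ennreal (exp (real (card I) * (c\<^sup>2 * s2 / 2)))"
    by (simp only: prod_constant ennreal_power[OF exp_ge_zero] exp_of_nat_mult)
  finally show ?thesis .
qed

text \<open>Duality of the l1 norm and the maximum norm: the supremum over the ball becomes a
  maximum over coordinates and signs. Bounding this maximum by a sum costs the factor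
  \<open>2 * p\<close> of the tail bounds.\<close>

lemma exp_dotp_le:
  assumes p: "p \<ge> 1" and v: "l1 v {1..p} \<le> r"
  shows "exp (dotp p v S) \<le> (\<Sum>j=1..p. exp (r * S j) + exp (- r * S j))"
proof -
  define m where "m = Max ((\<lambda>j. \<bar>S j\<bar>) ` {1..p})"
  have "m \<in> (\<lambda>j. \<bar>S j\<bar>) ` {1..p}" unfolding m_def using p by (intro Max_in) auto
  then obtain j where j: "j \<in> {1..p}" "m = \<bar>S j\<bar>" by auto
  have m: "\<bar>S i\<bar> \<le> m" if "i \<in> {1..p}" for i unfolding m_def using that by auto
  have "dotp p v S \<le> (\<Sum>i=1..p. \<bar>v i\<bar> * \<bar>S i\<bar>)"
    unfolding dotp_def by (intro sum_mono) (metis abs_ge_self abs_mult)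
  also have "\<dots> \<le> (\<Sum>i=1..p. \<bar>v i\<bar> * m)" using m by (intro sum_mono mult_left_mono) auto
  also have "\<dots> = l1 v {1..p} * m" by (simp add: l1_def sum_distrib_right)
  also have "\<dots> \<le> r * \<bar>S j\<bar>" using v j by (simp add: mult_right_mono)
  finally have "exp (dotp p v S) \<le> exp (r * \<bar>S j\<bar>)" by simp
  also have "\<dots> \<le> exp (r * S j) + exp (- r * S j)" by (cases "S j \<ge> 0") auto
  also have "\<dots> \<le> (\<Sum>j=1..p. exp (r * S j) + exp (- r * S j))"
    using j by (intro member_le_sum) (auto intro: add_nonneg_nonneg)
  finally show ?thesis .
qed

text \<open>After symmetrization and contraction the exponent is linear in \<open>v\<close>. The
  supremum over \<open>T\<close> is then bounded by l1 duality, and only exponential moments of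
  signed sums of single coordinates remain.\<close>

lemma (in prob_space) nn_integral_SUP_exp_centered_le:
  fixes I :: "'i set" and X :: "'a \<Rightarrow> nat \<Rightarrow> real" and F :: "(nat \<Rightarrow> real) \<Rightarrow> 'a \<Rightarrow> real"
  assumes T: "countable T" "T \<noteq> {}" and p: "p \<ge> 1" and I: "finite I" and L: "L \<ge> 0" and \<tau>: "\<tau> \<ge> 0"
    and F: "\<And>v. v \<in> T \<Longrightarrow> integrable M (F v)"
    and X: "\<And>j. j \<in> {1..p} \<Longrightarrow> subg M s2 (\<lambda>z. X z j)"
    and r: "\<And>v. v \<in> T \<Longrightarrow> l1 v {1..p} \<le> r"
    and bound: "\<And>v z. v \<in> T \<Longrightarrow> z \<in> space M \<Longrightarrow> \<bar>F v z\<bar> \<le> L * \<bar>dotp p v (X z)\<bar>"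
    and lip: "\<And>v w z. v \<in> T \<Longrightarrow> w \<in> T \<Longrightarrow> z \<in> space M \<Longrightarrow>
        \<bar>F v z - F w z\<bar> \<le> L * \<bar>dotp p v (X z) - dotp p w (X z)\<bar>"
  shows "(\<integral>\<^sup>+ z. (SUP v\<in>T. ennreal (exp (\<tau> * (\<Sum>i\<in>I. F v (z i) - (\<integral>z. F v z \<partial>M))))) \<partial>(PiM I (\<lambda>_. M)))
    \<le> ennreal (2 * real p * exp (2 * real (card I) * (\<tau> * L * r)\<^sup>2 * s2))"
proof -
  have [measurable]: "(\<lambda>z. X z j) \<in> borel_measurable M" if "j \<in> {1..p}" for j
    using X[OF that] by (simp add: subg_def)
  have [measurable]: "F v \<in> borel_measurable M" if "v \<in> T" for v using F[OF that] by auto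
  have dm[measurable]: "(\<lambda>z. dotp p v (X z)) \<in> borel_measurable M" for v
    unfolding dotp_def by measurable
  note [measurable] = T(1)
  interpret MC: pair_prob_space M coin by unfold_locales
  interpret P: prob_space "PiM I (\<lambda>_. M \<Otimes>\<^sub>M coin)" by (intro prob_space_PiM) unfold_locales
  let ?Q = "PiM I (\<lambda>_. M \<Otimes>\<^sub>M coin)"
  define S where "S j q = (\<Sum>i\<in>I. coin_sign (snd (q i)) * X (fst (q i)) j)" for j and q :: "'i \<Rightarrow> 'a \<times> bool"
  \<comment> \<open>The 2 stems from symmetrization and \<open>L\<close> from contraction. The
    moment bound at \<open>c * r\<close> thus has the exponent
    \<open>2 * (\<tau> * L * r)\<^sup>2 * s2\<close> per observation.\<close>
  define c where "c = 2 * \<tau> * L"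
  have "(\<integral>\<^sup>+ z. (SUP v\<in>T. ennreal (exp (0 + (\<Sum>i\<in>I. (\<tau> * F v (z i) - (\<integral>z. \<tau> * F v z \<partial>M)))))) \<partial>(PiM I (\<lambda>_. M)))
    \<le> (\<integral>\<^sup>+ q. (SUP v\<in>T. ennreal (exp (0 + (\<Sum>i\<in>I. coin_sign (snd (q i)) * (2 * (\<tau> * L * dotp p v (X (fst (q i))))))))) \<partial>?Q)"
  proof (rule nn_integral_SUP_exp_PiM_mono)
    show "prob_space M" "prob_space (M \<Otimes>\<^sub>M coin)" by unfold_locales
    show "(\<integral>\<^sup>+ z. (SUP v\<in>T. ennreal (exp (A v + (\<tau> * F v z - (\<integral>z. \<tau> * F v z \<partial>M))))) \<partial>M)
      \<le> (\<integral>\<^sup>+ q. (SUP v\<in>T. ennreal (exp (A v + coin_sign (snd q) * (2 * (\<tau> * L * dotp p v (X (fst q))))))) \<partial>(M \<Otimes>\<^sub>M coin))" for A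
    proof (rule exp_symmetrized_contraction[OF T])
      fix v z assume v: "v \<in> T" "z \<in> space M"
      then show "\<bar>\<tau> * F v z\<bar> \<le> \<bar>\<tau> * L * dotp p v (X z)\<bar>"
        using \<tau> L mult_left_mono[OF bound[OF v] \<tau>] by (simp add: abs_mult mult.assoc)
    next
      fix v w z assume v: "v \<in> T" "w \<in> T" "z \<in> space M"
      then show "\<bar>\<tau> * F v z - \<tau> * F w z\<bar> \<le> \<bar>\<tau> * L * dotp p v (X z) - \<tau> * L * dotp p w (X z)\<bar>"
        using \<tau> L mult_left_mono[OF lip[OF v] \<tau>] by (simp add: abs_mult mult.assoc flip: right_diff_distrib)
    qed (use F in auto)
  qed (use T I in auto)
  also have "\<dots> \<le> (\<integral>\<^sup>+ q. (\<Sum>j=1..p. ennreal (exp (c * r * S j q)) + ennreal (exp (- c * r * S j q))) \<partial>?Q)"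
  proof (intro nn_integral_mono SUP_least)
    fix q v assume v: "v \<in> T"
    \<comment> \<open>Exchanging the sums over observations and coordinates exhibits the exponent as
      an inner product of \<open>v\<close> with the scaled signed column sums.\<close>
    have "(\<Sum>i\<in>I. coin_sign (snd (q i)) * (2 * (\<tau> * L * dotp p v (X (fst (q i))))))
        = (\<Sum>i\<in>I. \<Sum>j=1..p. c * (v j * (coin_sign (snd (q i)) * X (fst (q i)) j)))"
      by (intro sum.cong) (auto simp: dotp_def c_def sum_distrib_left mult.assoc)
    also have "\<dots> = (\<Sum>j=1..p. \<Sum>i\<in>I. c * (v j * (coin_sign (snd (q i)) * X (fst (q i)) j)))"
      by (rule sum.swap)
    also have "\<dots> = dotp p v (\<lambda>j. c * S j q)"
      by (simp add: dotp_def S_def sum_distrib_left ac_simps)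
    finally have "exp (0 + (\<Sum>i\<in>I. coin_sign (snd (q i)) * (2 * (\<tau> * L * dotp p v (X (fst (q i)))))))
        \<le> (\<Sum>j=1..p. exp (r * (c * S j q)) + exp (- r * (c * S j q)))"
      using exp_dotp_le[OF p r[OF v]] by simp
    also have "\<dots> = (\<Sum>j=1..p. exp (c * r * S j q) + exp (- c * r * S j q))"
      by (simp add: ac_simps)
    finally have "ennreal (exp (0 + (\<Sum>i\<in>I. coin_sign (snd (q i)) * (2 * (\<tau> * L * dotp p v (X (fst (q i))))))))
        \<le> ennreal (\<Sum>j=1..p. exp (c * r * S j q) + exp (- c * r * S j q))"
      by (rule ennreal_leI)
    also have "\<dots> = (\<Sum>j=1..p. ennreal (exp (c * r * S j q)) + ennreal (exp (- c * r * S j q)))"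
      by (subst sum_ennreal[symmetric]) (auto intro: add_nonneg_nonneg)
    finally show "ennreal (exp (0 + (\<Sum>i\<in>I. coin_sign (snd (q i)) * (2 * (\<tau> * L * dotp p v (X (fst (q i))))))))
        \<le> (\<Sum>j=1..p. ennreal (exp (c * r * S j q)) + ennreal (exp (- c * r * S j q)))" .
  qed
  also have "\<dots> = (\<Sum>j=1..p. (\<integral>\<^sup>+ q. ennreal (exp (c * r * S j q)) \<partial>?Q) + (\<integral>\<^sup>+ q. ennreal (exp (- c * r * S j q)) \<partial>?Q))"
    unfolding S_def by (subst nn_integral_sum) (auto intro!: sum.cong nn_integral_add)
  also have "\<dots> \<le> (\<Sum>j=1..p. ennreal (exp (real (card I) * ((c * r)\<^sup>2 * s2 / 2))) + ennreal (exp (real (card I) * ((- c * r)\<^sup>2 * s2 / 2))))"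
    unfolding S_def using X I by (intro sum_mono add_mono nn_integral_sign_sum_le) unfold_locales
  also have "\<dots> = ennreal (2 * real p * exp (2 * real (card I) * (\<tau> * L * r)\<^sup>2 * s2))"
  proof -
    have e: "real (card I) * ((c * r)\<^sup>2 * s2 / 2) = 2 * real (card I) * (\<tau> * L * r)\<^sup>2 * s2"
      "real (card I) * ((- c * r)\<^sup>2 * s2 / 2) = 2 * real (card I) * (\<tau> * L * r)\<^sup>2 * s2"
      by (simp_all add: c_def power2_eq_square)
    have sum: "(\<Sum>j=1..p. ennreal y + ennreal y) = ennreal (2 * real p * y)" if "y \<ge> 0" for y
    proof -
      have "(\<Sum>j=1..p. ennreal y + ennreal y) = (\<Sum>j=1..p. ennreal (y + y))"
        using that by (simp only: ennreal_plus)
      also have "\<dots> = ennreal (\<Sum>j=1..p. y + y)"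
        using that by (intro sum_ennreal) auto
      also have "(\<Sum>j=1..p. y + y) = 2 * real p * y" by simp
      finally show ?thesis .
    qed
    show ?thesis unfolding e by (rule sum) simp
  qed
  also have "(\<integral>\<^sup>+ z. (SUP v\<in>T. ennreal (exp (0 + (\<Sum>i\<in>I. (\<tau> * F v (z i) - (\<integral>z. \<tau> * F v z \<partial>M)))))) \<partial>(PiM I (\<lambda>_. M)))
     = (\<integral>\<^sup>+ z. (SUP v\<in>T. ennreal (exp (\<tau> * (\<Sum>i\<in>I. F v (z i) - (\<integral>z. F v z \<partial>M))))) \<partial>(PiM I (\<lambda>_. M)))"
    by (simp add: sum_distrib_left right_diff_distrib)
  finally show ?thesis .
qed

section \<open>Tail bounds for suprema of iid sums\<close>

lemma subg_mono: "subg M s Z \<Longrightarrow> s \<le> s' \<Longrightarrow> subg M s' Z"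
  unfolding subg_def
  by (meson order_trans ennreal_leI exp_le_cancel_iff mult_left_mono divide_right_mono zero_le_power2 zero_le_numeral)

lemma subg_distr:
  assumes f[measurable]: "f \<in> measurable M N" and g: "g \<in> borel_measurable N"
  shows "subg (distr M N f) s g \<longleftrightarrow> subg M s (\<lambda>\<omega>. g (f \<omega>))"
proof -
  note [measurable] = g
  show ?thesis by (simp add: subg_def nn_integral_distr g)
qed

lemma (in prob_space) subg_exp_integrable:
  assumes "subg M s Z"
  shows "integrable M (\<lambda>\<omega>. exp (t * Z \<omega>))" "(\<integral>\<omega>. exp (t * Z \<omega>) \<partial>M) \<le> exp (t\<^sup>2 * s / 2)"
proof -
  have [measurable]: "Z \<in> borel_measurable M"
    and mgf: "(\<integral>\<^sup>+ \<omega>. ennreal (exp (t * Z \<omega>)) \<partial>M) \<le> ennreal (exp (t\<^sup>2 * s / 2))"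
    using assms by (auto simp: subg_def)
  show int: "integrable M (\<lambda>\<omega>. exp (t * Z \<omega>))"
    using mgf by (intro integrableI_bounded) (auto intro: le_less_trans)
  show "(\<integral>\<omega>. exp (t * Z \<omega>) \<partial>M) \<le> exp (t\<^sup>2 * s / 2)"
    using mgf int by (simp add: nn_integral_eq_integral)
qed

lemma (in prob_space) subg_integrable:
  assumes "subg M s Z"
  shows "integrable M Z"
proof (rule Bochner_Integration.integrable_bound)
  show "integrable M (\<lambda>\<omega>. exp (1 * Z \<omega>) + exp (- 1 * Z \<omega>))"
    by (intro Bochner_Integration.integrable_add subg_exp_integrable[OF assms])
  have "\<bar>z\<bar> \<le> exp z + exp (- z)" for z :: real
    using exp_ge_add_one_self[of z] exp_ge_add_one_self[of "- z"] exp_gt_zero[of z] exp_gt_zero[of "- z"] by linarith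
  then show "AE \<omega> in M. norm (Z \<omega>) \<le> norm (exp (1 * Z \<omega>) + exp (- 1 * Z \<omega>))"
    by simp
qed (use assms in \<open>simp add: subg_def\<close>)

text \<open>Since \<open>exp z \<ge> 1 + z\<close>, the function
  \<open>exp (t\<^sup>2 * s / 2) - 1 - t * m\<close>, with \<open>m\<close> the mean, is
  nonnegative. It vanishes at 0, so its derivative \<open>- m\<close> there is zero.\<close>

lemma (in prob_space) subg_mean_zero:
  assumes "subg M s Z"
  shows "(\<integral>\<omega>. Z \<omega> \<partial>M) = 0"
proof -
  let ?m = "\<integral>\<omega>. Z \<omega> \<partial>M"
  let ?f = "\<lambda>t::real. exp (t\<^sup>2 * s / 2) - 1 - t * ?m"
  have "?f t \<ge> ?f 0" for t
  proof -
    have "1 + t * ?m = (\<integral>\<omega>. 1 + t * Z \<omega> \<partial>M)"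
      using subg_integrable[OF assms] by (simp add: prob_space)
    also have "\<dots> \<le> (\<integral>\<omega>. exp (t * Z \<omega>) \<partial>M)"
      using subg_integrable[OF assms] by (intro integral_mono subg_exp_integrable[OF assms] exp_ge_add_one_self) auto
    also have "\<dots> \<le> exp (t\<^sup>2 * s / 2)" by (rule subg_exp_integrable[OF assms])
    finally show ?thesis by simp
  qed
  then have "- ?m = 0"
    by (intro DERIV_local_min[where f = ?f and x = 0 and d = 1]) (auto intro!: derivative_eq_intros)
  then show ?thesis by simp
qed

text \<open>Chernoff's method applied to the exponential moment of the supremum. Countability of
  \<open>T\<close> keeps the supremum and the event measurable.\<close>

lemma (in prob_space) sup_tail_iid:
  fixes Z :: "nat \<Rightarrow> 'a \<Rightarrow> 'b" and X :: "'b \<Rightarrow> nat \<Rightarrow> real" and F :: "(nat \<Rightarrow> real) \<Rightarrow> 'b \<Rightarrow> real"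
  assumes indep: "indep_vars (\<lambda>_. N) Z {1..n}"
    and D: "\<And>i. i \<in> {1..n} \<Longrightarrow> distr M N (Z i) = D"
    and n: "n \<ge> 1" and T: "countable T" and p: "p \<ge> 1"
    and pos: "L > 0" "r > 0" "s2 > 0" "c > 0"
    and F: "\<And>v. v \<in> T \<Longrightarrow> integrable D (F v)"
    and X: "\<And>j. j \<in> {1..p} \<Longrightarrow> subg D s2 (\<lambda>z. X z j)"
    and r: "\<And>v. v \<in> T \<Longrightarrow> l1 v {1..p} \<le> r"
    and bound: "\<And>v z. v \<in> T \<Longrightarrow> z \<in> space N \<Longrightarrow> \<bar>F v z\<bar> \<le> L * \<bar>dotp p v (X z)\<bar>"
    and lip: "\<And>v w z. v \<in> T \<Longrightarrow> w \<in> T \<Longrightarrow> z \<in> space N \<Longrightarrow>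
        \<bar>F v z - F w z\<bar> \<le> L * \<bar>dotp p v (X z) - dotp p w (X z)\<bar>"
  shows "prob {\<omega> \<in> space M. \<exists>v\<in>T. real n * c < (\<Sum>i=1..n. F v (Z i \<omega>) - (\<integral>z. F v z \<partial>D))}
    \<le> 2 * real p * exp (- real n * c\<^sup>2 / (8 * L\<^sup>2 * r\<^sup>2 * s2))"
proof (cases "T = {}")
  case False
  have Z[measurable]: "Z i \<in> measurable M N" if "i \<in> {1..n}" for i
    using indep that by (auto simp: indep_vars_def)
  have setsD: "sets D = sets N" and spaceD: "space D = space N" and pD: "prob_space D"
    using D[of 1] Z[of 1] n by (auto intro: prob_space_distr)
  interpret D: prob_space D by fact
  have FN: "F v \<in> borel_measurable N" if "v \<in> T" for v
    using F[OF that] by (simp add: borel_measurable_integrable measurable_cong_sets[OF setsD refl, symmetric])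
  note [measurable] = FN T
  \<comment> \<open>The minimizer of
    \<open>2 * n * (\<tau> * L * r)\<^sup>2 * s2 - \<tau> * n * c\<close>; the minimum is the
    exponent claimed.\<close>
  define \<tau> where "\<tau> = c / (4 * L\<^sup>2 * r\<^sup>2 * s2)"
  have \<tau>: "\<tau> > 0" using pos by (simp add: \<tau>_def)
  let ?W = "\<lambda>v \<omega>. (\<Sum>i=1..n. F v (Z i \<omega>) - (\<integral>z. F v z \<partial>D))"
  let ?G = "\<lambda>z. (SUP v\<in>T. ennreal (exp (\<tau> * (\<Sum>i=1..n. F v (z i) - (\<integral>z. F v z \<partial>D)))))"
  let ?E = "{\<omega> \<in> space M. \<exists>v\<in>T. real n * c < ?W v \<omega>}"
  have G: "?G \<in> borel_measurable (PiM {1..n} (\<lambda>_. N))" by measurable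
  \<comment> \<open>Independence and equal laws make the joint law of the sample a power of
    \<open>D\<close>, on which the moment bound is available.\<close>
  have law: "distr M (PiM {1..n} (\<lambda>_. N)) (\<lambda>\<omega>. \<lambda>i\<in>{1..n}. Z i \<omega>) = PiM {1..n} (\<lambda>_. D)"
  proof -
    have "distr M (PiM {1..n} (\<lambda>_. N)) (\<lambda>\<omega>. \<lambda>i\<in>{1..n}. Z i \<omega>) = PiM {1..n} (\<lambda>i. distr M N (Z i))"
      using indep n by (subst (asm) indep_vars_iff_distr_eq_PiM') auto
    also have "\<dots> = PiM {1..n} (\<lambda>_. D)" by (intro PiM_cong) (auto simp: D)
    finally show ?thesis .
  qed
  have "(\<integral>\<^sup>+ \<omega>. ?G (\<lambda>i. Z i \<omega>) \<partial>M) = (\<integral>\<^sup>+ \<omega>. ?G (\<lambda>i\<in>{1..n}. Z i \<omega>) \<partial>M)"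
    by simp
  also have "\<dots> = (\<integral>\<^sup>+ z. ?G z \<partial>distr M (PiM {1..n} (\<lambda>_. N)) (\<lambda>\<omega>. \<lambda>i\<in>{1..n}. Z i \<omega>))"
  proof (rule nn_integral_distr[symmetric])
    show "(\<lambda>\<omega>. \<lambda>i\<in>{1..n}. Z i \<omega>) \<in> measurable M (PiM {1..n} (\<lambda>_. N))" by measurable
  qed (use G in simp)
  also have "\<dots> \<le> ennreal (2 * real p * exp (2 * real n * (\<tau> * L * r)\<^sup>2 * s2))"
    unfolding law
    using D.nn_integral_SUP_exp_centered_le[of T p "{1..n}" L \<tau> F s2 X r] False T p pos \<tau> F X r bound lip
    by (simp add: spaceD)
  finally have mgf: "(\<integral>\<^sup>+ \<omega>. ?G (\<lambda>i. Z i \<omega>) \<partial>M) \<le> ennreal (2 * real p * exp (2 * real n * (\<tau> * L * r)\<^sup>2 * s2))" .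
  have "emeasure M ?E = (\<integral>\<^sup>+ \<omega>. indicator ?E \<omega> \<partial>M)"
    by (rule nn_integral_indicator[symmetric]) measurable
  also have "\<dots> \<le> (\<integral>\<^sup>+ \<omega>. ennreal (exp (- \<tau> * (real n * c))) * ?G (\<lambda>i. Z i \<omega>) \<partial>M)"
  proof (intro nn_integral_mono)
    fix \<omega> assume "\<omega> \<in> space M"
    show "indicator ?E \<omega> \<le> ennreal (exp (- \<tau> * (real n * c))) * ?G (\<lambda>i. Z i \<omega>)"
    proof (cases "\<omega> \<in> ?E")
      case True
      then obtain v where v: "v \<in> T" "real n * c < ?W v \<omega>" by auto
      have "(1::ennreal) \<le> ennreal (exp (- \<tau> * (real n * c)) * exp (\<tau> * ?W v \<omega>))"
        using v(2) \<tau> by (simp flip: exp_add)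
      also have "\<dots> = ennreal (exp (- \<tau> * (real n * c))) * ennreal (exp (\<tau> * ?W v \<omega>))"
        by (simp add: ennreal_mult')
      also have "\<dots> \<le> ennreal (exp (- \<tau> * (real n * c))) * ?G (\<lambda>i. Z i \<omega>)"
        by (intro mult_left_mono SUP_upper v(1)) simp
      finally show ?thesis using True by simp
    qed simp
  qed
  also have "\<dots> = ennreal (exp (- \<tau> * (real n * c))) * (\<integral>\<^sup>+ \<omega>. ?G (\<lambda>i. Z i \<omega>) \<partial>M)"
    by (rule nn_integral_cmult) measurable
  also have "\<dots> \<le> ennreal (exp (- \<tau> * (real n * c))) * ennreal (2 * real p * exp (2 * real n * (\<tau> * L * r)\<^sup>2 * s2))"
    by (intro mult_left_mono mgf) simp
  also have "\<dots> = ennreal (2 * real p * exp (2 * real n * (\<tau> * L * r)\<^sup>2 * s2 - \<tau> * (real n * c)))"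
    by (simp add: exp_diff exp_minus field_simps flip: ennreal_mult')
  also have "2 * real n * (\<tau> * L * r)\<^sup>2 * s2 - \<tau> * (real n * c) = - real n * c\<^sup>2 / (8 * L\<^sup>2 * r\<^sup>2 * s2)"
    using pos by (simp add: \<tau>_def field_simps power2_eq_square)
  finally show ?thesis by (simp add: emeasure_eq_measure)
qed simp

section \<open>Rational vectors as a countable dense family\<close>

lemma countable_rational_vectors: "countable {v. supp v \<subseteq> {1..p} \<and> (\<forall>j. v j \<in> \<rat>)}"
proof -
  have "{v. supp v \<subseteq> {1..p} \<and> (\<forall>j. v j \<in> \<rat>)}
      \<subseteq> (\<lambda>g j. if j \<in> {1..p} then g j else 0) ` (PiE {1..p} (\<lambda>_. \<rat>))"
  proof
    fix v assume v: "v \<in> {v. supp v \<subseteq> {1..p} \<and> (\<forall>j. v j \<in> \<rat>)}"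
    show "v \<in> (\<lambda>g j. if j \<in> {1..p} then g j else 0) ` (PiE {1..p} (\<lambda>_. \<rat>))"
    proof (rule image_eqI)
      show "v = (\<lambda>j. if j \<in> {1..p} then restrict v {1..p} j else 0)"
      proof
        fix j show "v j = (if j \<in> {1..p} then restrict v {1..p} j else 0)"
          using v by (cases "j \<in> {1..p}") (auto simp: supp_def)
      qed
      show "restrict v {1..p} \<in> PiE {1..p} (\<lambda>_. \<rat>)" using v by simp
    qed
  qed
  moreover have "countable (PiE {1..p} (\<lambda>_. \<rat> :: real set))"
    by (intro countable_PiE countable_rat) auto
  ultimately show ?thesis by (rule countable_subset[OF _ countable_image])
qed

text \<open>Lets bounds proved simultaneously on a countable family pass to all vectors by
  continuity. Each coordinate is approximated by rationals just above it.\<close>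

lemma rational_vector_approx:
  obtains w :: "nat \<Rightarrow> nat \<Rightarrow> real"
  where "\<And>m. supp (w m) \<subseteq> {1..p}" "\<And>m j. w m j \<in> \<rat>" "\<And>j. j \<in> {1..p} \<Longrightarrow> (\<lambda>m. w m j) \<longlonglongrightarrow> v j"
proof -
  have ex: "\<exists>q. q \<in> \<rat> \<and> v j < q \<and> q < v j + inverse (real (Suc m))" for m j
    using Rats_dense_in_real[of "v j" "v j + inverse (real (Suc m))"] by auto
  define q where "q m j = (SOME q. q \<in> \<rat> \<and> v j < q \<and> q < v j + inverse (real (Suc m)))" for m j
  have q: "q m j \<in> \<rat> \<and> v j < q m j \<and> q m j < v j + inverse (real (Suc m))" for m j
    unfolding q_def by (rule someI_ex[OF ex])
  define w where "w m j = (if j \<in> {1..p} then q m j else 0)" for m j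
  have "(\<lambda>m. w m j) \<longlonglongrightarrow> v j" if "j \<in> {1..p}" for j
  proof (rule tendsto_sandwich[where f = "\<lambda>_. v j"])
    show "(\<lambda>m. v j + inverse (real (Suc m))) \<longlonglongrightarrow> v j"
      using tendsto_add[OF tendsto_const LIMSEQ_inverse_real_of_nat, of "v j"] by simp
  qed (use q that in \<open>auto simp: w_def less_imp_le\<close>)
  then show thesis using q by (intro that[of w]) (auto simp: w_def supp_def)
qed

lemma dotp_add: "dotp p (\<lambda>j. b j + v j) x = dotp p b x + dotp p v x"
  by (simp add: dotp_def distrib_right sum.distrib)

lemma dotp_diff: "dotp p (\<lambda>j. b j - v j) x = dotp p b x - dotp p v x"
  by (simp add: dotp_def left_diff_distrib sum_subtractf)

lemma dotp_scale: "dotp p (\<lambda>j. c * b j) x = c * dotp p b x"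
  by (simp add: dotp_def sum_distrib_left mult.assoc)

section \<open>Risk and empirical risk at a fixed sample size, up to the uniform deviation
  bound\<close>

lemma measurable_coordinate:
  "j \<in> {1..p} \<Longrightarrow> (\<lambda>z. fst z j) \<in> borel_measurable (obs_space p)"
  unfolding obs_space_def by (intro measurable_compose[OF measurable_fst] measurable_component_singleton)

lemma measurable_label: "snd \<in> measurable (obs_space p) (count_space {0, 1})"
  unfolding obs_space_def by measurable

lemma measurable_dotp_obs: "(\<lambda>z. dotp p b (fst z)) \<in> borel_measurable (obs_space p)"
  unfolding dotp_def using measurable_coordinate by (intro borel_measurable_sum borel_measurable_times) auto

text \<open>One fixed index of the triangular array, so that all bounds here are non-asymptotic.
  \<open>s2\<close> is a variance proxy common to all coordinates. It is assumed for the
  observations \<open>Xs\<close> and reaches \<open>X\<close> through the common law.\<close>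

locale lipschitz_sample = prob_space M for M :: "'a measure" +
  fixes p n :: nat and X :: "'a \<Rightarrow> nat \<Rightarrow> real" and Y :: "'a \<Rightarrow> nat"
    and Xs :: "nat \<Rightarrow> 'a \<Rightarrow> nat \<Rightarrow> real" and Ys :: "nat \<Rightarrow> 'a \<Rightarrow> nat"
    and \<rho> :: "real \<Rightarrow> nat \<Rightarrow> real" and L s2 :: real
  assumes obs: "(\<lambda>\<omega>. (X \<omega>, Y \<omega>)) \<in> measurable M (obs_space p)"
    and iid: "iid_copies M p n X Y Xs Ys"
    and n: "n \<ge> 1" and p: "p \<ge> 1" and L: "L > 0" and s2: "s2 > 0"
    and convex: "\<And>y. y \<in> {0, 1} \<Longrightarrow> convex_on UNIV (\<lambda>t. \<rho> t y)"
    and lipschitz: "\<And>y. y \<in> {0, 1} \<Longrightarrow> L-lipschitz_on UNIV (\<lambda>t. \<rho> t y)"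
    and subgaussian: "\<And>i j. i \<in> {1..n} \<Longrightarrow> j \<in> {1..p} \<Longrightarrow> subg M s2 (\<lambda>\<omega>. Xs i \<omega> j)"
begin

abbreviation R :: "(nat \<Rightarrow> real) \<Rightarrow> real" where
  "R \<equiv> risk \<rho> M p X Y"

abbreviation Rn :: "'a \<Rightarrow> (nat \<Rightarrow> real) \<Rightarrow> real" where
  "Rn \<omega> \<equiv> emp_risk \<rho> p n (\<lambda>i. Xs i \<omega>) (\<lambda>i. Ys i \<omega>)"

abbreviation law :: "((nat \<Rightarrow> real) \<times> nat) measure" where
  "law \<equiv> distr M (obs_space p) (\<lambda>\<omega>. (X \<omega>, Y \<omega>))"

lemma obs_copy: "i \<in> {1..n} \<Longrightarrow> (\<lambda>\<omega>. (Xs i \<omega>, Ys i \<omega>)) \<in> measurable M (obs_space p)"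
  using iid unfolding iid_copies_def indep_vars_def by auto

lemma law_copy: "i \<in> {1..n} \<Longrightarrow> distr M (obs_space p) (\<lambda>\<omega>. (Xs i \<omega>, Ys i \<omega>)) = law"
  using iid unfolding iid_copies_def by auto

lemma label: "\<omega> \<in> space M \<Longrightarrow> Y \<omega> \<in> {0, 1}"
  and label_copy: "i \<in> {1..n} \<Longrightarrow> \<omega> \<in> space M \<Longrightarrow> Ys i \<omega> \<in> {0, 1}"
  using measurable_space[OF obs, of \<omega>] measurable_space[OF obs_copy, of i \<omega>]
  by (auto simp: obs_space_def space_pair_measure)

lemma loss_lipschitz: "y \<in> {0, 1} \<Longrightarrow> \<bar>\<rho> s y - \<rho> t y\<bar> \<le> L * \<bar>s - t\<bar>"
  using lipschitz_onD[OF lipschitz, of y s t] by (simp add: dist_real_def)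

text \<open>The loss is known to be continuous only for fixed labels 0 and 1, so measurability is
  glued together over the two values of the label.\<close>

lemma measurable_loss: "(\<lambda>z. \<rho> (dotp p b (fst z)) (snd z)) \<in> borel_measurable (obs_space p)"
proof (rule measurable_compose_countable'[where f = "\<lambda>y z. \<rho> (dotp p b (fst z)) y" and g = snd and I = "{0, 1}"])
  fix y :: nat assume "y \<in> {0, 1}"
  then have "(\<lambda>t. \<rho> t y) \<in> borel_measurable borel"
    using lipschitz_on_continuous_on[OF lipschitz] by (intro borel_measurable_continuous_onI) blast
  then show "(\<lambda>z. \<rho> (dotp p b (fst z)) y) \<in> borel_measurable (obs_space p)"
    by (rule measurable_compose[OF measurable_dotp_obs])
qed (use measurable_label in auto)

lemma subg_law: "j \<in> {1..p} \<Longrightarrow> subg law s2 (\<lambda>z. fst z j)"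
  using subgaussian[of 1 j] n subg_distr[OF obs_copy[of 1] measurable_coordinate[of j p], of s2] law_copy[of 1]
  by simp

lemma subg_X: "j \<in> {1..p} \<Longrightarrow> subg M s2 (\<lambda>\<omega>. X \<omega> j)"
  using subg_law[of j] subg_distr[OF obs measurable_coordinate[of j p], of s2] by simp

lemma integrable_X: "j \<in> {1..p} \<Longrightarrow> integrable M (\<lambda>\<omega>. X \<omega> j)"
  by (rule subg_integrable[OF subg_X])

lemma integrable_dotp: "integrable M (\<lambda>\<omega>. dotp p b (X \<omega>))"
  unfolding dotp_def using integrable_X by auto

lemma measurable_loss_X: "(\<lambda>\<omega>. \<rho> (dotp p b (X \<omega>)) (Y \<omega>)) \<in> borel_measurable M"
  using measurable_compose[OF obs measurable_loss[of b]] by simp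

lemma integrable_loss: "integrable M (\<lambda>\<omega>. \<rho> (dotp p b (X \<omega>)) (Y \<omega>))"
proof (rule Bochner_Integration.integrable_bound)
  show "integrable M (\<lambda>\<omega>. \<bar>\<rho> 0 0\<bar> + \<bar>\<rho> 0 1\<bar> + L * \<bar>dotp p b (X \<omega>)\<bar>)"
    using integrable_dotp by auto
  show "AE \<omega> in M. norm (\<rho> (dotp p b (X \<omega>)) (Y \<omega>)) \<le> norm (\<bar>\<rho> 0 0\<bar> + \<bar>\<rho> 0 1\<bar> + L * \<bar>dotp p b (X \<omega>)\<bar>)"
  proof (rule AE_I2)
    fix \<omega> assume "\<omega> \<in> space M"
    then show "norm (\<rho> (dotp p b (X \<omega>)) (Y \<omega>)) \<le> norm (\<bar>\<rho> 0 0\<bar> + \<bar>\<rho> 0 1\<bar> + L * \<bar>dotp p b (X \<omega>)\<bar>)"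
      using label[of \<omega>] loss_lipschitz[of "Y \<omega>" "dotp p b (X \<omega>)" 0] by auto
  qed
qed (rule measurable_loss_X)

lemma risk_law: "R b = (\<integral>z. \<rho> (dotp p b (fst z)) (snd z) \<partial>law)"
  unfolding risk_def by (subst integral_distr[OF obs measurable_loss]) simp

lemma integrable_loss_law: "integrable law (\<lambda>z. \<rho> (dotp p b (fst z)) (snd z))"
  by (subst integrable_distr_eq[OF obs measurable_loss]) (simp add: integrable_loss)

text \<open>The loss is Lipschitz and the coordinates are integrable: the risk changes by at most
  \<open>L\<close> times the coordinate differences weighted by the first absolute moments of
  \<open>X\<close>.\<close>

lemma risk_tendsto:
  assumes w: "\<And>j. j \<in> {1..p} \<Longrightarrow> (\<lambda>m. w m j) \<longlonglongrightarrow> v j"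
  shows "(\<lambda>m. R (w m)) \<longlonglongrightarrow> R v"
proof (rule LIM_zero_cancel)
  let ?B = "\<lambda>m. \<Sum>j=1..p. L * (\<bar>w m j - v j\<bar> * (\<integral>\<omega>. \<bar>X \<omega> j\<bar> \<partial>M))"
  have B: "\<bar>R (w m) - R v\<bar> \<le> ?B m" for m
  proof -
    have "\<bar>R (w m) - R v\<bar> = \<bar>\<integral>\<omega>. \<rho> (dotp p (w m) (X \<omega>)) (Y \<omega>) - \<rho> (dotp p v (X \<omega>)) (Y \<omega>) \<partial>M\<bar>"
      unfolding risk_def using integrable_loss by simp
    also have "\<dots> \<le> (\<integral>\<omega>. \<bar>\<rho> (dotp p (w m) (X \<omega>)) (Y \<omega>) - \<rho> (dotp p v (X \<omega>)) (Y \<omega>)\<bar> \<partial>M)"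
      by (rule integral_abs_bound)
    also have "\<dots> \<le> (\<integral>\<omega>. (\<Sum>j=1..p. L * (\<bar>w m j - v j\<bar> * \<bar>X \<omega> j\<bar>)) \<partial>M)"
    proof (intro integral_mono)
      fix \<omega> assume "\<omega> \<in> space M"
      then have "\<bar>\<rho> (dotp p (w m) (X \<omega>)) (Y \<omega>) - \<rho> (dotp p v (X \<omega>)) (Y \<omega>)\<bar>
          \<le> L * \<bar>dotp p (\<lambda>j. w m j - v j) (X \<omega>)\<bar>"
        using label loss_lipschitz by (simp add: dotp_diff)
      also have "\<dots> \<le> L * (\<Sum>j=1..p. \<bar>w m j - v j\<bar> * \<bar>X \<omega> j\<bar>)"
        unfolding dotp_def abs_mult[symmetric] using L by (intro mult_left_mono sum_abs) auto
      finally show "\<bar>\<rho> (dotp p (w m) (X \<omega>)) (Y \<omega>) - \<rho> (dotp p v (X \<omega>)) (Y \<omega>)\<bar>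
          \<le> (\<Sum>j=1..p. L * (\<bar>w m j - v j\<bar> * \<bar>X \<omega> j\<bar>))"
        by (simp add: sum_distrib_left)
    qed (use integrable_loss integrable_X in auto)
    also have "\<dots> = ?B m"
      using integrable_X by (subst Bochner_Integration.integral_sum) auto
    finally show ?thesis .
  qed
  have lim: "?B \<longlonglongrightarrow> (\<Sum>j=1..p. L * (\<bar>v j - v j\<bar> * (\<integral>\<omega>. \<bar>X \<omega> j\<bar> \<partial>M)))"
    using w by (intro tendsto_intros) auto
  then have "?B \<longlonglongrightarrow> 0" by simp
  then show "(\<lambda>m. R (w m) - R v) \<longlonglongrightarrow> 0"
    by (rule Lim_null_comparison[rotated]) (use B in \<open>auto intro!: always_eventually\<close>)
qed

lemma emp_risk_tendsto:
  assumes \<omega>: "\<omega> \<in> space M" and w: "\<And>j. j \<in> {1..p} \<Longrightarrow> ((\<lambda>m. w m j) \<longlongrightarrow> v j) G"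
  shows "((\<lambda>m. Rn \<omega> (w m)) \<longlongrightarrow> Rn \<omega> v) G"
proof -
  have "((\<lambda>m. \<rho> (dotp p (w m) (Xs i \<omega>)) (Ys i \<omega>)) \<longlongrightarrow> \<rho> (dotp p v (Xs i \<omega>)) (Ys i \<omega>)) G" if "i \<in> {1..n}" for i
  proof -
    have "continuous_on UNIV (\<lambda>t. \<rho> t (Ys i \<omega>))"
      using lipschitz_on_continuous_on[OF lipschitz] label_copy[OF that \<omega>] by blast
    moreover have "((\<lambda>m. dotp p (w m) (Xs i \<omega>)) \<longlongrightarrow> dotp p v (Xs i \<omega>)) G"
      unfolding dotp_def using w by (intro tendsto_intros) auto
    ultimately show ?thesis
      by (rule continuous_on_tendsto_compose) auto
  qed
  then show ?thesis unfolding emp_risk_def by (intro tendsto_intros) auto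
qed

text \<open>The process \<open>R\<^sub>n - R\<close> recentered at \<open>b\<close>. It vanishes in
  direction 0, as contraction requires, and a bound on it turns a risk increment into an empirical
  risk increment.\<close>

definition risk_deviation :: "(nat \<Rightarrow> real) \<Rightarrow> 'a \<Rightarrow> (nat \<Rightarrow> real) \<Rightarrow> real" where
  "risk_deviation b \<omega> v = (Rn \<omega> (\<lambda>j. b j + v j) - R (\<lambda>j. b j + v j)) - (Rn \<omega> b - R b)"

lemma risk_deviation_tendsto:
  assumes \<omega>: "\<omega> \<in> space M" and w: "\<And>j. j \<in> {1..p} \<Longrightarrow> (\<lambda>m. w m j) \<longlonglongrightarrow> v j"
  shows "(\<lambda>m. risk_deviation b \<omega> (w m)) \<longlonglongrightarrow> risk_deviation b \<omega> v"
  unfolding risk_deviation_def using w by (intro tendsto_diff emp_risk_tendsto[OF \<omega>] risk_tendsto tendsto_const tendsto_add) auto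

text \<open>The tail bound is applied on a countable family of rational directions, which makes the
  good event measurable. Continuity of the deviation in \<open>v\<close> then extends the bound to
  the whole ball, and hence to data-dependent directions.\<close>

lemma uniform_deviation:
  assumes r: "r > 0" and c: "c > 0"
  obtains E where "E \<in> sets M" "prob E \<ge> 1 - 4 * real p * exp (- real n * c\<^sup>2 / (32 * L\<^sup>2 * r\<^sup>2 * s2))"
    "\<And>\<omega> v. \<omega> \<in> E \<Longrightarrow> l1 v {1..p} \<le> r \<Longrightarrow> \<bar>risk_deviation b \<omega> v\<bar> \<le> c"
proof -
  \<comment> \<open>The radius \<open>2 * r\<close> leaves room for rational approximations of the vectors with \<open>l1 v \<le> r\<close>.\<close>
  define T where "T = {v. supp v \<subseteq> {1..p} \<and> (\<forall>j. v j \<in> \<rat>)} \<inter> {v. l1 v {1..p} \<le> 2 * r}"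
  have T: "countable T" unfolding T_def by (rule countable_Int1[OF countable_rational_vectors])
  note [measurable] = T
  define F where "F v z = \<rho> (dotp p (\<lambda>j. b j + v j) (fst z)) (snd z) - \<rho> (dotp p b (fst z)) (snd z)"
    for v and z :: "(nat \<Rightarrow> real) \<times> nat"
  let ?S = "\<lambda>v \<omega>. \<Sum>i=1..n. F v (Xs i \<omega>, Ys i \<omega>) - (\<integral>z. F v z \<partial>law)"
  have F_int: "integrable law (F v)" for v
    unfolding F_def by (intro Bochner_Integration.integrable_diff integrable_loss_law)
  have [measurable]: "F v \<in> borel_measurable (obs_space p)" for v
    unfolding F_def using measurable_loss by auto
  have [measurable]: "(\<lambda>\<omega>. F v (Xs i \<omega>, Ys i \<omega>)) \<in> borel_measurable M" if "i \<in> {1..n}" for i v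
    by (rule measurable_compose[OF obs_copy[OF that]]) simp
  have S: "?S v \<omega> = real n * risk_deviation b \<omega> v" for v \<omega>
  proof -
    have "(\<integral>z. F v z \<partial>law) = R (\<lambda>j. b j + v j) - R b"
      unfolding F_def risk_law by (simp add: integrable_loss_law)
    then have "?S v \<omega> = (\<Sum>i=1..n. F v (Xs i \<omega>, Ys i \<omega>)) - real n * (R (\<lambda>j. b j + v j) - R b)"
      by (simp add: sum_subtractf)
    also have "(\<Sum>i=1..n. F v (Xs i \<omega>, Ys i \<omega>)) = real n * (Rn \<omega> (\<lambda>j. b j + v j) - Rn \<omega> b)"
      using n by (simp add: F_def emp_risk_def sum_subtractf right_diff_distrib)
    finally show ?thesis by (simp add: risk_deviation_def algebra_simps)
  qed
  define E where "E = {\<omega> \<in> space M. \<forall>v\<in>T. \<bar>?S v \<omega>\<bar> \<le> real n * c}"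
  let ?E1 = "{\<omega> \<in> space M. \<exists>v\<in>T. real n * c < ?S v \<omega>}"
  let ?E2 = "{\<omega> \<in> space M. \<exists>v\<in>T. real n * c < (\<Sum>i=1..n. - F v (Xs i \<omega>, Ys i \<omega>) - (\<integral>z. - F v z \<partial>law))}"
  let ?q = "2 * real p * exp (- real n * c\<^sup>2 / (32 * L\<^sup>2 * r\<^sup>2 * s2))"
  have E: "E \<in> sets M" unfolding E_def by measurable
  have lab: "snd z \<in> {0, 1}" if "z \<in> space (obs_space p)" for z
    using that by (auto simp: obs_space_def space_pair_measure)
  \<comment> \<open>The tail bound is one-sided, so it is used for \<open>F\<close> and for
    \<open>- F\<close>, whence the factor 4. The doubled radius turns the constant 8 into
    32.\<close>
  have tail: "prob {\<omega> \<in> space M. \<exists>v\<in>T. real n * c < (\<Sum>i=1..n. a * F v (Xs i \<omega>, Ys i \<omega>) - (\<integral>z. a * F v z \<partial>law))}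
      \<le> 2 * real p * exp (- real n * c\<^sup>2 / (8 * L\<^sup>2 * (2 * r)\<^sup>2 * s2))" if a: "\<bar>a\<bar> = 1" for a
  proof (rule sup_tail_iid[where N = "obs_space p" and X = fst and T = T and r = "2 * r" and L = L])
    show "indep_vars (\<lambda>_. obs_space p) (\<lambda>i \<omega>. (Xs i \<omega>, Ys i \<omega>)) {1..n}"
      using iid by (simp add: iid_copies_def)
    fix v z assume z: "z \<in> space (obs_space p)"
    show "\<bar>a * F v z\<bar> \<le> L * \<bar>dotp p v (fst z)\<bar>"
      using loss_lipschitz[OF lab[OF z]] a by (simp add: F_def dotp_add abs_mult) (metis add_diff_cancel_left')
    fix w
    have "\<bar>a * F v z - a * F w z\<bar> = \<bar>F v z - F w z\<bar>" using a by (simp add: abs_mult flip: right_diff_distrib)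
    also have "\<dots> \<le> L * \<bar>(dotp p b (fst z) + dotp p v (fst z)) - (dotp p b (fst z) + dotp p w (fst z))\<bar>"
      using loss_lipschitz[OF lab[OF z], of "dotp p b (fst z) + dotp p v (fst z)" "dotp p b (fst z) + dotp p w (fst z)"]
      by (simp add: F_def dotp_add)
    finally show "\<bar>a * F v z - a * F w z\<bar> \<le> L * \<bar>dotp p v (fst z) - dotp p w (fst z)\<bar>" by simp
  qed (use law_copy n p L s2 r c T F_int subg_law in \<open>auto simp: T_def\<close>)
  have "prob ?E1 \<le> ?q" "prob ?E2 \<le> ?q"
    using tail[of 1] tail[of "- 1"] by (simp_all add: power_mult_distrib mult.assoc)
  moreover have "space M - E \<subseteq> ?E1 \<union> ?E2"
    by (auto simp: E_def abs_le_iff not_le sum_negf sum_subtractf)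
  then have "prob (space M - E) \<le> prob (?E1 \<union> ?E2)"
    by (intro finite_measure_mono) measurable
  moreover have "prob (?E1 \<union> ?E2) \<le> prob ?E1 + prob ?E2"
    by (intro measure_Un_le) measurable
  ultimately have "prob E \<ge> 1 - 2 * ?q" using prob_compl[OF E] by linarith
  moreover have "\<bar>risk_deviation b \<omega> v\<bar> \<le> c" if \<omega>: "\<omega> \<in> E" and v: "l1 v {1..p} \<le> r" for \<omega> v
  proof -
    have \<omega>': "\<omega> \<in> space M" using \<omega> by (simp add: E_def)
    obtain w where w: "\<And>m. supp (w m) \<subseteq> {1..p}" "\<And>m j. w m j \<in> \<rat>"
      "\<And>j. j \<in> {1..p} \<Longrightarrow> (\<lambda>m. w m j) \<longlonglongrightarrow> v j" using rational_vector_approx by blast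
    have "(\<lambda>m. l1 (w m) {1..p}) \<longlonglongrightarrow> l1 v {1..p}"
      unfolding l1_def using w(3) by (intro tendsto_intros) auto
    \<comment> \<open>The approximating vectors may have a norm slightly above \<open>r\<close>;
      being below \<open>2 * r\<close> already puts them into \<open>T\<close>.\<close>
    then have "eventually (\<lambda>m. l1 (w m) {1..p} < 2 * r) sequentially"
      by (rule order_tendstoD) (use v r in auto)
    then have "eventually (\<lambda>m. \<bar>risk_deviation b \<omega> (w m)\<bar> \<le> c) sequentially"
    proof eventually_elim
      case (elim m)
      then have "w m \<in> T" using w by (simp add: T_def)
      then have "\<bar>real n * risk_deviation b \<omega> (w m)\<bar> \<le> real n * c" using \<omega> S by (simp add: E_def)
      then show ?case using n by (simp add: abs_mult)
    qed
    then show ?thesis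
      using tendsto_rabs[OF risk_deviation_tendsto[OF \<omega>' w(3)]] by (intro tendsto_upperbound) auto
  qed
  ultimately show thesis using E by (intro that[of E]) auto
qed

end

section \<open>Collinearity of the risk minimizer with the index vector\<close>

lemma (in prob_space) sigma_finite_subalgebra_vimage:
  assumes "f \<in> measurable M N"
  shows "sigma_finite_subalgebra M (vimage_algebra (space M) f N)"
proof -
  have "subalgebra M (vimage_algebra (space M) f N)"
    using sets_image_in_sets[OF _ assms, of "space M"] by (simp add: subalgebra_def)
  then have "finite_measure_subalgebra M (vimage_algebra (space M) f N)"
    by unfold_locales
  then show ?thesis by (rule finite_measure_subalgebra_is_sigma_finite)
qed

text \<open>The infimum of the slopes to the right is a monotone selection of subgradients, hence
  Borel, and the Lipschitz constant bounds it. This makes first-order expansions of the loss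
  integrable.\<close>

lemma convex_lipschitz_subgradient:
  fixes f :: "real \<Rightarrow> real"
  assumes f: "convex_on UNIV f" and lip: "L-lipschitz_on UNIV f"
  obtains \<phi> where "\<phi> \<in> borel_measurable borel" "\<And>t. \<bar>\<phi> t\<bar> \<le> L" "\<And>s t. f s \<ge> f t + \<phi> t * (s - t)"
proof -
  define \<phi> where "\<phi> x = Inf ((\<lambda>t. (f x - f t) / (x - t)) ` ({x<..} \<inter> UNIV))" for x
  have sub: "f s \<ge> f t + \<phi> t * (s - t)" for s t
    unfolding \<phi>_def by (rule convex_le_Inf_differential[OF f]) auto
  have "mono \<phi>"
  proof (rule monoI)
    fix s t :: real assume "s \<le> t"
    show "\<phi> s \<le> \<phi> t"
    proof (cases "s = t")
      case False
      then have "s < t" using \<open>s \<le> t\<close> by simp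
      have "\<phi> s * (t - s) \<le> \<phi> t * (t - s)"
        using sub[of s t] sub[of t s] by (simp add: algebra_simps)
      then show ?thesis using \<open>s < t\<close> by simp
    qed simp
  qed
  moreover have "\<bar>\<phi> t\<bar> \<le> L" for t
    using sub[of t "t + 1"] sub[of t "t - 1"] lipschitz_onD[OF lip, of "t + 1" t] lipschitz_onD[OF lip, of "t - 1" t]
    by (auto simp: dist_real_def)
  ultimately show thesis using sub that[of \<phi>] borel_measurable_mono by blast
qed

context lipschitz_sample
begin

lemma measurable_dotp_X: "(\<lambda>\<omega>. dotp p b (X \<omega>)) \<in> borel_measurable M"
  using integrable_dotp by auto

text \<open>Taking expectations in the regression equation removes every term but the intercept,
  because \<open>X\<close> and hence \<open>b\<^sup>TX\<close> are centered.\<close>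

lemma linear_regressions_intercept:
  assumes lrc: "linear_regressions M p X b u0 u" and j: "j \<in> {1..p}"
  shows "u0 j = 0"
proof -
  interpret F: sigma_finite_subalgebra M "vimage_algebra (space M) (\<lambda>\<omega>. dotp p b (X \<omega>)) borel"
    by (rule sigma_finite_subalgebra_vimage[OF measurable_dotp_X])
  have EX: "(\<integral>\<omega>. X \<omega> j \<partial>M) = 0" if "j \<in> {1..p}" for j
    by (rule subg_mean_zero[OF subg_X[OF that]])
  have "(\<integral>\<omega>. dotp p b (X \<omega>) \<partial>M) = 0"
    unfolding dotp_def using integrable_X EX by (subst Bochner_Integration.integral_sum) auto
  then have "u0 j = (\<integral>\<omega>. u0 j + u j * dotp p b (X \<omega>) \<partial>M)"
    using integrable_dotp by (simp add: prob_space)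
  also have "\<dots> = (\<integral>\<omega>. real_cond_exp M (vimage_algebra (space M) (\<lambda>\<omega>. dotp p b (X \<omega>)) borel) (\<lambda>\<omega>. X \<omega> j) \<omega> \<partial>M)"
    using lrc j measurable_dotp_X
    by (intro integral_cong_AE) (auto simp: linear_regressions_def eq_commute[of "u0 j + _"])
  also have "\<dots> = 0"
    using F.real_cond_exp_int(2)[OF integrable_X[OF j]] EX[OF j] by simp
  finally show ?thesis .
qed

text \<open>The regression of \<open>c\<^sup>TX\<close> on \<open>b\<^sup>TX\<close> has slope
  \<open>dotp p c u\<close> and no intercept. The residual has conditional mean zero given
  \<open>b\<^sup>TX\<close> and is orthogonal to every bounded Borel function of it.\<close>

lemma integral_weighted_residual:
  assumes lrc: "linear_regressions M p X b u0 u"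
    and \<phi>: "\<phi> \<in> borel_measurable borel" "\<And>t. \<bar>\<phi> t\<bar> \<le> K"
  shows "integrable M (\<lambda>\<omega>. \<phi> (dotp p b (X \<omega>)) * (dotp p c (X \<omega>) - dotp p c u * dotp p b (X \<omega>)))" (is "integrable M ?h")
    and "(\<integral>\<omega>. \<phi> (dotp p b (X \<omega>)) * (dotp p c (X \<omega>) - dotp p c u * dotp p b (X \<omega>)) \<partial>M) = 0"
proof -
  let ?g = "\<lambda>\<omega>. dotp p b (X \<omega>)"
  let ?F = "vimage_algebra (space M) ?g borel"
  interpret F: sigma_finite_subalgebra M ?F
    by (rule sigma_finite_subalgebra_vimage[OF measurable_dotp_X])
  note [measurable] = \<phi>(1) measurable_dotp_X
  have gF: "(\<lambda>\<omega>. \<phi> (?g \<omega>)) \<in> borel_measurable ?F"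
    by (rule measurable_compose[OF measurable_vimage_algebra1 \<phi>(1)]) simp
  have bdd: "integrable M (\<lambda>\<omega>. \<phi> (?g \<omega>) * f \<omega>)" if f: "integrable M f" for f
  proof (rule Bochner_Integration.integrable_bound)
    show "integrable M (\<lambda>\<omega>. K * f \<omega>)" using f by simp
    show "(\<lambda>\<omega>. \<phi> (?g \<omega>) * f \<omega>) \<in> borel_measurable M" using f by measurable
    show "AE \<omega> in M. norm (\<phi> (?g \<omega>) * f \<omega>) \<le> norm (K * f \<omega>)"
    proof (rule AE_I2)
      fix \<omega>
      have "\<bar>\<phi> (?g \<omega>)\<bar> \<le> \<bar>K\<bar>" using \<phi>(2)[of "?g \<omega>"] by linarith
      then show "norm (\<phi> (?g \<omega>) * f \<omega>) \<le> norm (K * f \<omega>)"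
        by (simp add: abs_mult mult_right_mono)
    qed
  qed
  have coord: "(\<integral>\<omega>. \<phi> (?g \<omega>) * X \<omega> j \<partial>M) = (\<integral>\<omega>. \<phi> (?g \<omega>) * (u j * ?g \<omega>) \<partial>M)" if j: "j \<in> {1..p}" for j
  proof -
    have "(\<integral>\<omega>. \<phi> (?g \<omega>) * X \<omega> j \<partial>M) = (\<integral>\<omega>. \<phi> (?g \<omega>) * real_cond_exp M ?F (\<lambda>\<omega>. X \<omega> j) \<omega> \<partial>M)"
      using integrable_X[OF j] by (intro F.real_cond_exp_intg(2)[symmetric] bdd gF) auto
    also have "\<dots> = (\<integral>\<omega>. \<phi> (?g \<omega>) * (u j * ?g \<omega>) \<partial>M)"
    proof (rule integral_cong_AE)
      have "AE \<omega> in M. real_cond_exp M ?F (\<lambda>\<omega>. X \<omega> j) \<omega> = u0 j + u j * ?g \<omega>"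
        using lrc j by (simp add: linear_regressions_def)
      then show "AE \<omega> in M. \<phi> (?g \<omega>) * real_cond_exp M ?F (\<lambda>\<omega>. X \<omega> j) \<omega> = \<phi> (?g \<omega>) * (u j * ?g \<omega>)"
        by eventually_elim (simp add: linear_regressions_intercept[OF lrc j])
    qed measurable
    finally show ?thesis .
  qed
  have h: "?h \<omega> = (\<Sum>j=1..p. c j * (\<phi> (?g \<omega>) * X \<omega> j) - c j * (\<phi> (?g \<omega>) * (u j * ?g \<omega>)))" for \<omega>
  proof -
    have "dotp p c (X \<omega>) - dotp p c u * ?g \<omega> = (\<Sum>j=1..p. c j * X \<omega> j - c j * u j * ?g \<omega>)"
      by (simp add: dotp_def[of p c] sum_subtractf sum_distrib_right)
    then show ?thesis
      by (simp add: sum_distrib_left right_diff_distrib ac_simps)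
  qed
  have int: "integrable M (\<lambda>\<omega>. \<phi> (?g \<omega>) * X \<omega> j)" "integrable M (\<lambda>\<omega>. \<phi> (?g \<omega>) * (u j * ?g \<omega>))" if "j \<in> {1..p}" for j
    using integrable_X[OF that] integrable_dotp by (auto intro!: bdd)
  show "integrable M ?h" unfolding h using int by auto
  show "(\<integral>\<omega>. ?h \<omega> \<partial>M) = 0"
    unfolding h using int coord by (subst Bochner_Integration.integral_sum) (auto intro!: sum.neutral)
qed

text \<open>Given \<open>X\<close>, the label enters only through a function of
  \<open>b\<^sup>TX\<close>. Conditioning on \<open>X\<close> therefore replaces the indicator of
  label 1 by another bounded weight in \<open>b\<^sup>TX\<close>, and the orthogonality without
  labels applies.\<close>

lemma integral_weighted_residual_label:
  assumes lrc: "linear_regressions M p X b u0 u" and model: "semiparametric_model M p X Y b q"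
    and q: "q \<in> borel_measurable borel"
    and \<phi>: "\<phi> \<in> borel_measurable borel" "\<And>t. \<bar>\<phi> t\<bar> \<le> K"
  shows "(\<integral>\<omega>. of_bool (Y \<omega> = 1) * (\<phi> (dotp p b (X \<omega>)) * (dotp p c (X \<omega>) - dotp p c u * dotp p b (X \<omega>))) \<partial>M) = 0"
    (is "(\<integral>\<omega>. ?Y \<omega> * ?h \<omega> \<partial>M) = 0")
    and "integrable M (\<lambda>\<omega>. of_bool (Y \<omega> = 1) * (\<phi> (dotp p b (X \<omega>)) * (dotp p c (X \<omega>) - dotp p c u * dotp p b (X \<omega>))))"
proof -
  let ?g = "\<lambda>\<omega>. dotp p b (X \<omega>)"
  let ?N = "PiM {1..p} (\<lambda>_. borel :: real measure)"
  let ?F = "vimage_algebra (space M) X ?N"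
  have X: "X \<in> measurable M ?N"
    using measurable_compose[OF obs[unfolded obs_space_def] measurable_fst] by simp
  have Y: "Y \<in> measurable M (count_space {0, 1})"
    using measurable_compose[OF obs[unfolded obs_space_def] measurable_snd] by simp
  have ind: "(\<lambda>y. of_bool (y = 1) :: real) \<in> borel_measurable (count_space {0, 1 :: nat})"
    by simp
  have Ym[measurable]: "?Y \<in> borel_measurable M"
    by (rule measurable_compose[OF Y ind])
  interpret F: sigma_finite_subalgebra M ?F
    by (rule sigma_finite_subalgebra_vimage[OF X])
  have XF: "X \<in> measurable ?F ?N"
    using measurable_space[OF X] by (intro measurable_vimage_algebra1) auto
  have dF[measurable]: "(\<lambda>\<omega>. dotp p a (X \<omega>)) \<in> borel_measurable ?F" for a
    unfolding dotp_def
    by (intro borel_measurable_sum borel_measurable_times borel_measurable_const measurable_compose[OF XF] measurable_component_singleton)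
  note [measurable] = \<phi>(1) q measurable_dotp_X
  \<comment> \<open>Clipping to the unit interval changes nothing almost surely along
    \<open>b\<^sup>TX\<close>, since \<open>q\<close> is a conditional probability there, but it
    bounds the weight everywhere.\<close>
  define qc where "qc t = max 0 (min 1 (q t))" for t
  have qc[measurable]: "qc \<in> borel_measurable borel" unfolding qc_def by measurable
  have Yint: "integrable M ?Y"
    by (rule integrable_const_bound[where B = 1, OF _ Ym]) auto
  have "AE \<omega> in M. real_cond_exp M ?F ?Y \<omega> \<ge> 0" "AE \<omega> in M. real_cond_exp M ?F ?Y \<omega> \<le> 1"
    by (rule F.real_cond_exp_ge_c[OF Yint] F.real_cond_exp_le_c[OF Yint]; simp)+
  then have cond: "AE \<omega> in M. real_cond_exp M ?F ?Y \<omega> = qc (?g \<omega>)"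
    using model unfolding semiparametric_model_def by eventually_elim (auto simp: qc_def)
  have hint: "integrable M ?h" by (rule integral_weighted_residual[OF lrc \<phi>])
  show int: "integrable M (\<lambda>\<omega>. ?Y \<omega> * ?h \<omega>)"
    by (rule Bochner_Integration.integrable_bound[OF hint borel_measurable_times[OF Ym borel_measurable_integrable[OF hint]]]) auto
  have hF: "?h \<in> borel_measurable ?F" by measurable
  have "(\<integral>\<omega>. ?Y \<omega> * ?h \<omega> \<partial>M) = (\<integral>\<omega>. ?h \<omega> * ?Y \<omega> \<partial>M)" by (simp only: mult.commute)
  also have "\<dots> = (\<integral>\<omega>. ?h \<omega> * real_cond_exp M ?F ?Y \<omega> \<partial>M)"
    by (rule F.real_cond_exp_intg(2)[OF _ hF Ym, symmetric]) (use int in \<open>simp only: mult.commute\<close>)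
  also have "\<dots> = (\<integral>\<omega>. (qc (?g \<omega>) * \<phi> (?g \<omega>)) * (dotp p c (X \<omega>) - dotp p c u * ?g \<omega>) \<partial>M)"
  proof (rule integral_cong_AE)
    show "AE \<omega> in M. ?h \<omega> * real_cond_exp M ?F ?Y \<omega>
        = (qc (?g \<omega>) * \<phi> (?g \<omega>)) * (dotp p c (X \<omega>) - dotp p c u * ?g \<omega>)"
      using cond by eventually_elim (simp add: ac_simps)
  qed measurable
  also have "\<dots> = 0"
  proof (rule integral_weighted_residual[OF lrc, where \<phi> = "\<lambda>t. qc t * \<phi> t"])
    show "\<bar>qc t * \<phi> t\<bar> \<le> K" for t
    proof -
      have "\<bar>qc t\<bar> * \<bar>\<phi> t\<bar> \<le> 1 * \<bar>\<phi> t\<bar>" by (intro mult_right_mono) (auto simp: qc_def)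
      then show ?thesis using \<phi>(2)[of t] by (simp add: abs_mult)
    qed
  qed measurable
  finally show "(\<integral>\<omega>. ?Y \<omega> * ?h \<omega> \<partial>M) = 0" .
qed

text \<open>Jensen's inequality given \<open>b\<^sup>TX\<close> and \<open>Y\<close>, in the form of a first-order expansion at the
  conditional mean of \<open>c\<^sup>TX\<close>. The intercept of the linear regressions vanishes because \<open>X\<close> is centered.\<close>

lemma risk_projection_le:
  assumes lrc: "linear_regressions M p X b u0 u" and model: "semiparametric_model M p X Y b q"
    and q: "q \<in> borel_measurable borel"
  shows "R (\<lambda>j. dotp p c u * b j) \<le> R c"
proof -
  let ?g = "\<lambda>\<omega>. dotp p b (X \<omega>)" and ?\<eta> = "dotp p c u"
  let ?Y = "\<lambda>\<omega>. of_bool (Y \<omega> = 1) :: real"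
  obtain \<phi>0 where \<phi>0: "\<phi>0 \<in> borel_measurable borel" "\<And>t. \<bar>\<phi>0 t\<bar> \<le> L" "\<And>s t. \<rho> s 0 \<ge> \<rho> t 0 + \<phi>0 t * (s - t)"
    using convex_lipschitz_subgradient[OF convex lipschitz, of 0] by auto
  obtain \<phi>1 where \<phi>1: "\<phi>1 \<in> borel_measurable borel" "\<And>t. \<bar>\<phi>1 t\<bar> \<le> L" "\<And>s t. \<rho> s 1 \<ge> \<rho> t 1 + \<phi>1 t * (s - t)"
    using convex_lipschitz_subgradient[OF convex lipschitz, of 1] by auto
  note [measurable] = \<phi>0(1) \<phi>1(1)
  have m: "(\<lambda>t. \<phi>0 (?\<eta> * t)) \<in> borel_measurable borel" "(\<lambda>t. \<phi>1 (?\<eta> * t)) \<in> borel_measurable borel"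
    by measurable
  let ?Z = "\<lambda>\<omega>. dotp p c (X \<omega>) - ?\<eta> * ?g \<omega>"
  let ?h0 = "\<lambda>\<omega>. \<phi>0 (?\<eta> * ?g \<omega>) * ?Z \<omega>" and ?h1 = "\<lambda>\<omega>. \<phi>1 (?\<eta> * ?g \<omega>) * ?Z \<omega>"
  note r0 = integral_weighted_residual[OF lrc m(1) \<phi>0(2), of c]
  note l0 = integral_weighted_residual_label[OF lrc model q m(1) \<phi>0(2), of c]
  note l1 = integral_weighted_residual_label[OF lrc model q m(2) \<phi>1(2), of c]
  have loss: "integrable M (\<lambda>\<omega>. \<rho> (?\<eta> * ?g \<omega>) (Y \<omega>))"
    using integrable_loss[of "\<lambda>j. ?\<eta> * b j"] by (simp add: dotp_scale)
  \<comment> \<open>The added terms form the subgradient correction, \<open>?h1\<close> for label 1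
    and \<open>?h0\<close> for label 0. Each of them integrates to zero, so the subgradient
    inequality can be applied pointwise to the integrand.\<close>
  have "R (\<lambda>j. ?\<eta> * b j) = (\<integral>\<omega>. \<rho> (?\<eta> * ?g \<omega>) (Y \<omega>) + (?Y \<omega> * ?h1 \<omega> + (?h0 \<omega> - ?Y \<omega> * ?h0 \<omega>)) \<partial>M)"
    using r0 l0 l1 loss by (simp add: risk_def dotp_scale)
  also have "\<dots> \<le> R c"
    unfolding risk_def
  proof (rule integral_mono)
    fix \<omega> assume "\<omega> \<in> space M"
    then consider "Y \<omega> = 0" | "Y \<omega> = 1" using label[of \<omega>] by auto
    then show "\<rho> (?\<eta> * ?g \<omega>) (Y \<omega>) + (?Y \<omega> * ?h1 \<omega> + (?h0 \<omega> - ?Y \<omega> * ?h0 \<omega>)) \<le> \<rho> (dotp p c (X \<omega>)) (Y \<omega>)"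
      using \<phi>0(3)[of "?\<eta> * ?g \<omega>" "dotp p c (X \<omega>)"] \<phi>1(3)[of "?\<eta> * ?g \<omega>" "dotp p c (X \<omega>)"]
      by cases simp_all
  qed (use r0 l0 l1 loss integrable_loss in auto)
  finally show ?thesis .
qed

lemma supp_risk_minimizer:
  assumes lrc: "linear_regressions M p X b u0 u" and model: "semiparametric_model M p X Y b q"
    and q: "q \<in> borel_measurable borel" and b: "supp b \<subseteq> {1..p}"
    and min: "is_arg_min R (\<lambda>b. supp b \<subseteq> {1..p}) c"
    and unique: "\<And>c'. is_arg_min R (\<lambda>b. supp b \<subseteq> {1..p}) c' \<Longrightarrow> c' = c"
    and nz: "c \<noteq> (\<lambda>_. 0)"
  shows "supp c = supp b"
proof -
  \<comment> \<open>The projection of the minimizer onto the line of \<open>b\<close> is again a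
    minimizer, so uniqueness identifies the two.\<close>
  have "is_arg_min R (\<lambda>b. supp b \<subseteq> {1..p}) (\<lambda>j. dotp p c u * b j)"
    unfolding is_arg_min_def
  proof (intro conjI notI; (elim exE conjE)?)
    show "supp (\<lambda>j. dotp p c u * b j) \<subseteq> {1..p}" using b by (auto simp: supp_def)
  next
    fix y assume "supp y \<subseteq> {1..p}" "R y < R (\<lambda>j. dotp p c u * b j)"
    moreover from this(1) have "\<not> R y < R c" using min by (auto simp: is_arg_min_def)
    ultimately show False using risk_projection_le[OF lrc model q, of c] by linarith
  qed
  from unique[OF this] have "(\<lambda>j. dotp p c u * b j) = c" .
  then have eq: "c j = dotp p c u * b j" for j by (metis (no_types))
  then have "dotp p c u \<noteq> 0" using nz by (metis ext mult_zero_left)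
  then show ?thesis using eq by (simp add: supp_def)
qed

end

section \<open>Localization of the empirical minimizers by convexity\<close>

lemma zero_outside_supp: "supp b \<subseteq> w \<Longrightarrow> j \<notin> w \<Longrightarrow> b j = 0"
  by (auto simp: supp_def)

lemma supp_subsetI: "(\<And>j. j \<notin> w \<Longrightarrow> b j = 0) \<Longrightarrow> supp b \<subseteq> w"
  by (auto simp: supp_def)

lemma supp_add: "supp b \<subseteq> w \<Longrightarrow> supp v \<subseteq> w \<Longrightarrow> supp (\<lambda>j. b j + v j) \<subseteq> w"
  by (rule supp_subsetI) (simp add: zero_outside_supp)

lemma supp_diff: "supp b \<subseteq> w \<Longrightarrow> supp v \<subseteq> w \<Longrightarrow> supp (b - v) \<subseteq> w"
  by (rule supp_subsetI) (simp add: zero_outside_supp)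

text \<open>Tychonoff's theorem on the full function space. Degenerate intervals are included, so
  that coordinates outside a model can be pinned to 0.\<close>

lemma compact_box:
  fixes l u :: "nat \<Rightarrow> real"
  shows "compact {b. \<forall>i. b i \<in> {l i..u i}}"
proof -
  have "compactin (product_topology (\<lambda>_. euclidean) UNIV) (PiE UNIV (\<lambda>i. {l i..u i}))"
    unfolding compactin_PiE by simp
  moreover have "PiE UNIV (\<lambda>i. {l i..u i}) = {b. \<forall>i. b i \<in> {l i..u i}}"
    by (auto simp: PiE_def Pi_def)
  ultimately show ?thesis by (simp only: euclidean_product_topology compactin_euclidean_iff)
qed

text \<open>Outside a box around \<open>b0\<close> the objective exceeds its value at
  \<open>b0\<close>, so its minimum over the compact box is global. Existence matters because
  \<open>arg_min_choice\<close> yields a minimizer only when there is one.\<close>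

lemma ex_is_arg_min_coercive:
  fixes f :: "(nat \<Rightarrow> real) \<Rightarrow> real"
  assumes cont: "continuous_on UNIV f" and b0: "supp b0 \<subseteq> w" and r: "r \<ge> 0"
    and far: "\<And>b j. supp b \<subseteq> w \<Longrightarrow> \<bar>b j - b0 j\<bar> > r \<Longrightarrow> f b > f b0"
  shows "\<exists>y. is_arg_min f (\<lambda>b. supp b \<subseteq> w) y"
proof -
  define K where "K = {b. \<forall>i. b i \<in> {(if i \<in> w then b0 i - r else 0)..(if i \<in> w then b0 i + r else 0)}}"
  have "compact K" unfolding K_def by (rule compact_box)
  have b0K: "b0 \<in> K" using r by (simp add: K_def zero_outside_supp[OF b0])
  then obtain y where y: "y \<in> K" "\<And>z. z \<in> K \<Longrightarrow> f y \<le> f z"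
    using continuous_attains_inf[OF \<open>compact K\<close> _ continuous_on_subset[OF cont subset_UNIV]] by auto
  have "supp y \<subseteq> w"
  proof
    fix j assume "j \<in> supp y"
    with y(1) show "j \<in> w" by (cases "j \<in> w") (auto simp: K_def supp_def dest!: spec[of _ j])
  qed
  moreover have "f y \<le> f z" if z: "supp z \<subseteq> w" for z
  proof (cases "z \<in> K")
    case False
    then obtain j where "z j \<notin> {(if j \<in> w then b0 j - r else 0)..(if j \<in> w then b0 j + r else 0)}"
      by (auto simp: K_def)
    then have "\<bar>z j - b0 j\<bar> > r" using zero_outside_supp[OF z, of j] by (auto split: if_splits)
    then have "f b0 < f z" by (rule far[OF z])
    then show ?thesis using y(2)[OF b0K] by simp
  qed (use y in auto)
  ultimately show ?thesis by (auto simp: is_arg_min_def not_less)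
qed

lemma arg_min_choice_le:
  assumes "arg_min_choice f P x" "\<exists>y. is_arg_min f P y" "P z"
  shows "f x \<le> f z"
  using assms unfolding arg_min_choice_def is_arg_min_def by (meson not_less)

text \<open>A vector outside the sphere is shrunk onto it. By convexity the increment at the
  shrunken vector is at most \<open>t\<close> times the full increment, with
  \<open>t \<le> 1\<close>; so a gain of more than \<open>d \<ge> 0\<close> on the sphere persists
  outside.\<close>

lemma ray_escape:
  fixes f :: "(nat \<Rightarrow> real) \<Rightarrow> real" and N :: "(nat \<Rightarrow> real) \<Rightarrow> real"
  assumes convex: "\<And>v t. 0 \<le> t \<Longrightarrow> t \<le> 1 \<Longrightarrow> f (\<lambda>j. b0 j + t * v j) \<le> (1 - t) * f b0 + t * f (\<lambda>j. b0 j + v j)"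
    and N: "\<And>v t. t \<ge> 0 \<Longrightarrow> N (\<lambda>j. t * v j) = t * N v"
    and r: "r > 0" and d: "d \<ge> 0"
    and sphere: "\<And>v. supp v \<subseteq> w \<Longrightarrow> N v = r \<Longrightarrow> f (\<lambda>j. b0 j + v j) > f b0 + d"
    and v: "supp v \<subseteq> w" "N v \<ge> r"
  shows "f (\<lambda>j. b0 j + v j) > f b0 + d"
proof -
  define t where "t = r / N v"
  have t: "0 < t" "t \<le> 1" using r v by (auto simp: t_def)
  have "N (\<lambda>j. t * v j) = r" using N[of t v] t r v by (simp add: t_def)
  moreover have "supp (\<lambda>j. t * v j) \<subseteq> w" using v by (auto simp: supp_def)
  ultimately have "f b0 + d < f (\<lambda>j. b0 j + t * v j)" by (rule sphere[rotated])
  also have "\<dots> \<le> (1 - t) * f b0 + t * f (\<lambda>j. b0 j + v j)" using t by (intro convex) auto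
  finally have *: "d < t * (f (\<lambda>j. b0 j + v j) - f b0)" by (simp add: algebra_simps)
  then have "0 < f (\<lambda>j. b0 j + v j) - f b0" using d t by (smt (verit) zero_less_mult_pos)
  then have "t * (f (\<lambda>j. b0 j + v j) - f b0) \<le> 1 * (f (\<lambda>j. b0 j + v j) - f b0)"
    using t by (intro mult_right_mono) auto
  with * show ?thesis by simp
qed

section \<open>Norm inequalities, the smallest coefficient and the nested models\<close>

lemma l1_scale: "t \<ge> 0 \<Longrightarrow> l1 (\<lambda>j. t * v j) A = t * l1 v A"
  by (simp add: l1_def abs_mult sum_distrib_left)

lemma abs_le_l1: "finite A \<Longrightarrow> j \<in> A \<Longrightarrow> \<bar>v j\<bar> \<le> l1 v A"
  unfolding l1_def by (rule member_le_sum) auto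

lemma l1_split: "S \<subseteq> {1..p} \<Longrightarrow> l1 v {1..p} = l1 v S + l1 v ({1..p} - S)"
  unfolding l1_def by (subst sum.subset_diff[of S]) (auto simp: add.commute)

lemma l1_le_sqrt_card_L2_set:
  assumes "finite A"
  shows "l1 v A \<le> sqrt (card A) * L2_set v A"
proof -
  have "(\<Sum>i\<in>A. \<bar>1\<bar> * \<bar>v i\<bar>) \<le> L2_set (\<lambda>_. 1) A * L2_set v A" by (rule L2_set_mult_ineq)
  moreover have "L2_set (\<lambda>_. 1 :: real) A = sqrt (card A)" by (simp add: L2_set_def)
  ultimately show ?thesis by (simp add: l1_def)
qed

lemma L2_set_supp:
  assumes "supp v \<subseteq> A" "A \<subseteq> B" "finite B"
  shows "L2_set v B = L2_set v A" "l1 v B = l1 v A"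
  using assms by (auto simp: L2_set_def l1_def supp_def intro!: sum.mono_neutral_right arg_cong[of _ _ sqrt])

text \<open>The support is finite and nonempty, so the infimum is attained at a nonzero coefficient
  and the conversion from extended reals loses nothing.\<close>

lemma min_coef1_supp:
  assumes "finite (supp b)" "b \<noteq> (\<lambda>_. 0)"
  shows "min_coef1 b > 0" "min_coef1 b \<le> 1" "\<And>j. j \<in> supp b \<Longrightarrow> min_coef1 b \<le> \<bar>b j\<bar>"
proof -
  have "supp b \<noteq> {}" using assms(2) by (auto simp: supp_def)
  then have "min_coef b \<in> (\<lambda>j. ereal \<bar>b j\<bar>) ` supp b"
    unfolding min_coef_def using assms(1) by (subst Min_Inf[symmetric]) (auto intro: Min_in)
  then obtain i where i: "i \<in> supp b" "min_coef b = ereal \<bar>b i\<bar>" by auto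
  have eq: "min_coef1 b = min \<bar>b i\<bar> 1"
    unfolding min_coef1_def i(2) by (simp add: min_def flip: one_ereal_def)
  show "min_coef1 b > 0" "min_coef1 b \<le> 1" using i(1) by (auto simp: eq supp_def)
  show "min_coef1 b \<le> \<bar>b j\<bar>" if "j \<in> supp b" for j
  proof -
    have "min_coef b \<le> ereal \<bar>b j\<bar>" unfolding min_coef_def by (rule INF_lower[OF that])
    then show ?thesis by (simp add: eq i(2))
  qed
qed

text \<open>Every index of \<open>S\<close> precedes every other index in the list. A prefix that
  contains a foreign index has therefore exhausted \<open>S\<close>, and the prefix of length
  \<open>card S\<close> can only be \<open>S\<close> itself.\<close>

lemma ss_models_separated:
  assumes js: "ordered_supp b js" and S: "finite S"
    and big: "\<And>i. i \<in> S \<Longrightarrow> m < \<bar>b i\<bar>" and small: "\<And>j. j \<notin> S \<Longrightarrow> \<bar>b j\<bar> < m" and m: "m \<ge> 0"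
  shows "S \<in> ss_models js" "\<And>w. w \<in> ss_models js \<Longrightarrow> w \<subseteq> S \<or> S \<subseteq> w"
proof -
  have dist: "distinct js" and set: "set js = supp b" and sorted: "sorted_wrt (\<lambda>i j. \<bar>b i\<bar> \<ge> \<bar>b j\<bar>) js"
    using js by (auto simp: ordered_supp_def)
  have S_js: "S \<subseteq> set js"
  proof
    fix i assume "i \<in> S"
    then show "i \<in> set js" using big[of i] m by (auto simp: set supp_def)
  qed
  have nested: "set (take l js) \<subseteq> S \<or> S \<subseteq> set (take l js)" for l
  proof (rule ccontr)
    assume "\<not> ?thesis"
    then obtain i j where j: "j \<in> set (take l js)" "j \<notin> S" and i: "i \<in> S" "i \<notin> set (take l js)" by auto
    have "set js = set (take l js) \<union> set (drop l js)" by (metis append_take_drop_id set_append)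
    then have "i \<in> set (drop l js)" using i S_js by auto
    moreover have "sorted_wrt (\<lambda>i j. \<bar>b i\<bar> \<ge> \<bar>b j\<bar>) (take l js @ drop l js)" using sorted by simp
    ultimately have "\<bar>b j\<bar> \<ge> \<bar>b i\<bar>" using j(1) unfolding sorted_wrt_append by blast
    then show False using big[OF i(1)] small[OF j(2)] by simp
  qed
  then show "w \<in> ss_models js \<Longrightarrow> w \<subseteq> S \<or> S \<subseteq> w" for w
    by (auto simp: ss_models_def)
  let ?w = "set (take (card S) js)"
  have le: "card S \<le> length js"
    using card_mono[OF _ S_js] distinct_card[OF dist] by simp
  then have "card ?w = card S"
    using distinct_card[OF distinct_take[OF dist]] by simp
  then have "?w = S"
    using nested[of "card S"] S by (metis List.finite_set card_subset_eq)
  then show "S \<in> ss_models js"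
    unfolding ss_models_def using le by (metis atLeastAtMost_iff imageI zero_le)
qed

section \<open>Lasso separation, comparison of nested models and the probability of correct
  selection\<close>

context lipschitz_sample
begin

lemma emp_risk_continuous: "\<omega> \<in> space M \<Longrightarrow> continuous_on UNIV (Rn \<omega>)"
  unfolding continuous_on_def
  using continuous_on_product_coordinates[where ?'a = nat and ?'b = real]
  by (auto intro!: emp_risk_tendsto simp: continuous_on_def)

lemma emp_risk_convex:
  assumes \<omega>: "\<omega> \<in> space M" and t: "0 \<le> t" "t \<le> 1"
  shows "Rn \<omega> (\<lambda>j. b j + t * v j) \<le> (1 - t) * Rn \<omega> b + t * Rn \<omega> (\<lambda>j. b j + v j)"
proof -
  have "\<rho> (dotp p (\<lambda>j. b j + t * v j) (Xs i \<omega>)) (Ys i \<omega>)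
      \<le> (1 - t) * \<rho> (dotp p b (Xs i \<omega>)) (Ys i \<omega>) + t * \<rho> (dotp p (\<lambda>j. b j + v j) (Xs i \<omega>)) (Ys i \<omega>)"
    if i: "i \<in> {1..n}" for i
  proof -
    have "dotp p (\<lambda>j. b j + t * v j) (Xs i \<omega>)
        = (1 - t) * dotp p b (Xs i \<omega>) + t * dotp p (\<lambda>j. b j + v j) (Xs i \<omega>)"
      by (simp add: dotp_add dotp_scale algebra_simps)
    then show ?thesis
      using convex_onD[OF convex[OF label_copy[OF i \<omega>]] t, of "dotp p b (Xs i \<omega>)" "dotp p (\<lambda>j. b j + v j) (Xs i \<omega>)"]
      by simp
  qed
  then have "(\<Sum>i=1..n. \<rho> (dotp p (\<lambda>j. b j + t * v j) (Xs i \<omega>)) (Ys i \<omega>))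
      \<le> (\<Sum>i=1..n. (1 - t) * \<rho> (dotp p b (Xs i \<omega>)) (Ys i \<omega>) + t * \<rho> (dotp p (\<lambda>j. b j + v j) (Xs i \<omega>)) (Ys i \<omega>))"
    by (intro sum_mono)
  then have "Rn \<omega> (\<lambda>j. b j + t * v j) \<le> (1 / real n) * \<dots>"
    unfolding emp_risk_def by (intro mult_left_mono) auto
  also have "\<dots> = (1 - t) * Rn \<omega> b + t * Rn \<omega> (\<lambda>j. b j + v j)"
    by (simp add: emp_risk_def sum.distrib distrib_left sum_distrib_left mult.left_commute add_divide_distrib)
  finally show ?thesis .
qed

text \<open>By convexity only the l1 sphere of radius \<open>r\<close> matters. With
  \<open>x\<close> the l1 norm of \<open>v\<close> on the support, the penalty contributes at least
  \<open>lam * (r - 2 * x)\<close> and the deviation costs at most \<open>lam * r / 4\<close>.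
  Outside the cone \<open>x\<close> is small enough for the penalty to win; inside, the curvature of
  the risk makes up for it.\<close>

lemma lasso_objective_escape:
  fixes k :: nat and lam r \<theta>a \<kappa>0 e \<delta> :: real and H :: "nat \<Rightarrow> nat \<Rightarrow> real"
  assumes \<omega>: "\<omega> \<in> space M" and bs: "supp bs \<subseteq> {1..p}" and card: "card (supp bs) \<le> k" and k: "k \<ge> 1"
    and min: "\<And>b. supp b \<subseteq> {1..p} \<Longrightarrow> R bs \<le> R b"
    and cond_a: "\<And>b. supp b \<subseteq> {1..p} \<Longrightarrow> b - bs \<in> cone_eps p (supp bs) e \<inter> l1_ball p \<delta> \<Longrightarrow>
        R b - R bs \<ge> \<theta>a / 2 * quad p H (b - bs)"
    and kap: "\<And>v. v \<in> cone_eps p (supp bs) e \<Longrightarrow> v \<noteq> (\<lambda>_. 0) \<Longrightarrow> \<kappa>0 * dotp p v v \<le> quad p H v"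
    and pos: "\<kappa>0 > 0" "\<theta>a > 0" "e > 0" "lam > 0"
    and r: "r = 4 * real k * lam / (\<theta>a * \<kappa>0)" and r\<delta>: "r \<le> \<delta>"
    and dev: "\<And>v. l1 v {1..p} \<le> r \<Longrightarrow> \<bar>risk_deviation bs \<omega> v\<bar> \<le> lam * r / 4"
    and v: "supp v \<subseteq> {1..p}" "l1 v {1..p} \<ge> r"
  shows "Rn \<omega> (\<lambda>j. bs j + v j) + lam * l1 (\<lambda>j. bs j + v j) {1..p} > Rn \<omega> bs + lam * l1 bs {1..p}"
proof -
  let ?Q = "\<lambda>b. Rn \<omega> b + lam * l1 b {1..p}"
  let ?S = "supp bs"
  have r0: "r > 0" using pos k by (simp add: r)
  have finS: "finite ?S" using bs by (rule finite_subset) simp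
  have "?Q (\<lambda>j. bs j + v j) > ?Q bs + 0"
  proof (rule ray_escape[where N = "\<lambda>v. l1 v {1..p}" and w = "{1..p}" and r = r and f = ?Q])
    fix v and t :: real assume t: "0 \<le> t" "t \<le> 1"
    have "l1 (\<lambda>j. bs j + t * v j) {1..p} \<le> (\<Sum>j=1..p. (1 - t) * \<bar>bs j\<bar> + t * \<bar>bs j + v j\<bar>)"
      unfolding l1_def
    proof (rule sum_mono)
      fix j
      have "\<bar>bs j + t * v j\<bar> = \<bar>(1 - t) * bs j + t * (bs j + v j)\<bar>" by (simp add: algebra_simps)
      also have "\<dots> \<le> \<bar>(1 - t) * bs j\<bar> + \<bar>t * (bs j + v j)\<bar>" by (rule abs_triangle_ineq)
      finally show "\<bar>bs j + t * v j\<bar> \<le> (1 - t) * \<bar>bs j\<bar> + t * \<bar>bs j + v j\<bar>"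
        using t by (simp add: abs_mult)
    qed
    also have "\<dots> = (1 - t) * l1 bs {1..p} + t * l1 (\<lambda>j. bs j + v j) {1..p}"
      by (simp add: l1_def sum.distrib sum_distrib_left)
    finally have "lam * l1 (\<lambda>j. bs j + t * v j) {1..p} \<le> lam * ((1 - t) * l1 bs {1..p} + t * l1 (\<lambda>j. bs j + v j) {1..p})"
      using pos by (intro mult_left_mono) auto
    then show "?Q (\<lambda>j. bs j + t * v j) \<le> (1 - t) * ?Q bs + t * ?Q (\<lambda>j. bs j + v j)"
      using emp_risk_convex[OF \<omega> t, of bs v] by (simp add: algebra_simps)
  next
    fix v assume v: "supp v \<subseteq> {1..p}" "l1 v {1..p} = r"
    define x where "x = l1 v ?S"
    have x0: "x \<ge> 0" by (simp add: x_def l1_def sum_nonneg)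
    have split: "r = x + l1 v ({1..p} - ?S)" using l1_split[OF bs, of v] v by (simp add: x_def)
    have sup: "supp (\<lambda>j. bs j + v j) \<subseteq> {1..p}"
      by (rule supp_add[OF bs v(1)])
    have diff: "(\<lambda>j. bs j + v j) - bs = v" by (simp add: fun_eq_iff)
    have risk: "Rn \<omega> (\<lambda>j. bs j + v j) - Rn \<omega> bs \<ge> (R (\<lambda>j. bs j + v j) - R bs) - lam * r / 4"
      using dev[OF eq_refl[OF v(2)]] unfolding risk_deviation_def by linarith
    \<comment> \<open>Decomposability of the l1 norm: off the support \<open>bs\<close> vanishes, so
      there the penalty grows by the full norm of \<open>v\<close>; on the support it drops by at
      most \<open>x\<close>.\<close>
    have "l1 bs {1..p} - x + l1 v ({1..p} - ?S) \<le> l1 (\<lambda>j. bs j + v j) {1..p}"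
    proof -
      have "l1 bs ?S \<le> l1 (\<lambda>j. bs j + v j) ?S + x"
        unfolding l1_def x_def sum.distrib[symmetric] by (intro sum_mono) linarith
      moreover have "l1 bs ({1..p} - ?S) = 0" "l1 (\<lambda>j. bs j + v j) ({1..p} - ?S) = l1 v ({1..p} - ?S)"
        by (auto simp: l1_def supp_def)
      ultimately show ?thesis using l1_split[OF bs, of bs] l1_split[OF bs, of "\<lambda>j. bs j + v j"] by simp
    qed
    then have "lam * (r - 2 * x) \<le> lam * (l1 (\<lambda>j. bs j + v j) {1..p} - l1 bs {1..p})"
      using pos split by (intro mult_left_mono) auto
    then have pen: "lam * r - 2 * lam * x \<le> lam * l1 (\<lambda>j. bs j + v j) {1..p} - lam * l1 bs {1..p}"
      by (simp add: algebra_simps)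
    show "?Q bs + 0 < ?Q (\<lambda>j. bs j + v j)"
    proof (cases "v \<in> cone_eps p ?S e")
      case False
      then have "(3 + e) * x < l1 v ({1..p} - ?S)" using v by (simp add: cone_eps_def x_def)
      moreover have "3 * x \<le> (3 + e) * x" using x0 pos by (simp add: distrib_right)
      \<comment> \<open>Then \<open>r - 2 * x - r / 4 > r / 4\<close>, so the penalty alone beats
        the deviation.\<close>
      ultimately have "4 * x < r" using split by simp
      then have "4 * (lam * x) < lam * r" using pos by (simp add: mult.left_commute)
      moreover have "lam * r > 0" using pos r0 by simp
      moreover have "R (\<lambda>j. bs j + v j) \<ge> R bs" by (rule min[OF sup])
      ultimately show ?thesis using risk pen by simp
    next
      case True
      have nz: "v \<noteq> (\<lambda>_. 0)" using v r0 by (auto simp: l1_def)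
      have "x\<^sup>2 \<le> (sqrt (card ?S) * L2_set v ?S)\<^sup>2"
        using l1_le_sqrt_card_L2_set[OF finS, of v] x0 by (intro power_mono) (auto simp: x_def)
      also have "\<dots> = real (card ?S) * (\<Sum>j\<in>?S. v j * v j)"
          by (simp add: power_mult_distrib L2_set_def sum_nonneg flip: power2_eq_square)
      also have "\<dots> \<le> real k * dotp p v v"
        unfolding dotp_def using card bs by (intro mult_mono sum_mono2 sum_nonneg) auto
      finally have x2: "x\<^sup>2 \<le> real k * dotp p v v" .
      \<comment> \<open>Collects the constants of the lower bound \<open>A * x\<^sup>2\<close> for
        the risk increment: Cauchy-Schwarz on at most \<open>k\<close> coordinates, the restricted
        eigenvalue and the curvature.\<close>
      define A where "A = \<theta>a * \<kappa>0 / (2 * real k)"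
      have A: "A > 0" using pos k by (simp add: A_def)
      have "A * x\<^sup>2 \<le> A * (real k * dotp p v v)" using A x2 by (intro mult_left_mono) auto
      also have "\<dots> = \<theta>a / 2 * (\<kappa>0 * dotp p v v)" using k by (simp add: A_def)
      also have "\<dots> \<le> \<theta>a / 2 * quad p H v" using kap[OF True nz] pos by (intro mult_left_mono) auto
      also have "\<dots> \<le> R (\<lambda>j. bs j + v j) - R bs"
        using cond_a[OF sup] True v r\<delta> diff by (simp add: l1_ball_def)
      finally have quad: "A * x\<^sup>2 \<le> R (\<lambda>j. bs j + v j) - R bs" .
      \<comment> \<open>This relation dictates the radius: it turns the quadratic in
        \<open>A * x\<close> into a square plus the positive remainder
        \<open>lam\<^sup>2 / 2\<close>.\<close>
      have Ar: "A * r = 2 * lam" using pos k by (simp add: A_def r field_simps)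
      have "A * (3 / 4 * lam * r - 2 * lam * x + A * x\<^sup>2) = (A * x - lam)\<^sup>2 + lam\<^sup>2 / 2"
      proof -
        have "A * (3 / 4 * lam * r - 2 * lam * x + A * x\<^sup>2) = 3 / 4 * lam * (A * r) - 2 * lam * (A * x) + (A * x)\<^sup>2"
          by (simp add: algebra_simps power2_eq_square)
        then show ?thesis unfolding Ar by (simp add: power2_eq_square algebra_simps)
      qed
      moreover have "(A * x - lam)\<^sup>2 + lam\<^sup>2 / 2 > 0" using pos by (intro add_nonneg_pos) auto
      ultimately have "A * (3 / 4 * lam * r - 2 * lam * x + A * x\<^sup>2) > 0" by (simp only:)
      then have "3 / 4 * lam * r - 2 * lam * x + A * x\<^sup>2 > 0" by (rule zero_less_mult_pos[OF _ A])
      then show ?thesis using risk pen quad by simp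
    qed
  qed (use r0 v in \<open>auto simp: l1_scale\<close>)
  then show ?thesis by simp
qed

text \<open>On a model with at most \<open>k\<close> coordinates the l1 norm is at most
  \<open>sqrt k\<close> times the l2 norm, so an l1 deviation bound controls an l2 ball of the
  model.\<close>

lemma emp_risk_near:
  assumes dev: "\<And>v. l1 v {1..p} \<le> sqrt (real k) * r \<Longrightarrow> \<bar>risk_deviation bs \<omega> v\<bar> \<le> c"
    and A: "A \<subseteq> {1..p}" "card A \<le> k" and v: "supp v \<subseteq> A" "L2_set v {1..p} \<le> r"
  shows "Rn \<omega> (\<lambda>j. bs j + v j) - Rn \<omega> bs \<ge> (R (\<lambda>j. bs j + v j) - R bs) - c"
proof -
  have finA: "finite A" using A by (simp add: finite_subset)
  have "l1 v {1..p} \<le> sqrt (card A) * L2_set v {1..p}"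
    using L2_set_supp[OF v(1) A(1)] l1_le_sqrt_card_L2_set[OF finA, of v] by simp
  also have "\<dots> \<le> sqrt (real k) * r"
    using A v by (intro mult_mono) auto
  finally show ?thesis using dev[of v] by (simp add: risk_deviation_def)
qed

text \<open>On the l2 sphere the risk gains at least \<open>\<theta> * r\<^sup>2\<close> while the
  deviation takes back at most \<open>c\<close>, which leaves more than \<open>d\<close>. The margin
  \<open>d\<close> serves to beat a difference of penalties.\<close>

lemma emp_risk_escape:
  assumes \<omega>: "\<omega> \<in> space M"
    and dev: "\<And>v. l1 v {1..p} \<le> sqrt (real k) * r \<Longrightarrow> \<bar>risk_deviation bs \<omega> v\<bar> \<le> c"
    and A: "A \<subseteq> {1..p}" "card A \<le> k" "supp bs \<subseteq> A"
    and cond_b: "\<And>b. supp b \<subseteq> A \<Longrightarrow> L2_set (b - bs) {1..p} \<le> \<epsilon> \<Longrightarrow>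
        R b - R bs \<ge> \<theta> * (L2_set (b - bs) {1..p})\<^sup>2"
    and r: "r > 0" "r \<le> \<epsilon>" and d: "d \<ge> 0" "c + d < \<theta> * r\<^sup>2"
    and v: "supp v \<subseteq> A" "L2_set v {1..p} \<ge> r"
  shows "Rn \<omega> (\<lambda>j. bs j + v j) > Rn \<omega> bs + d"
proof (rule ray_escape[where N = "\<lambda>v. L2_set v {1..p}" and w = A and r = r])
  fix v assume v: "supp v \<subseteq> A" "L2_set v {1..p} = r"
  have "supp (\<lambda>j. bs j + v j) \<subseteq> A" by (rule supp_add[OF A(3) v(1)])
  moreover have "(\<lambda>j. bs j + v j) - bs = v" by (simp add: fun_eq_iff)
  ultimately have "R (\<lambda>j. bs j + v j) - R bs \<ge> \<theta> * r\<^sup>2"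
    using cond_b[of "\<lambda>j. bs j + v j"] r v by simp
  then show "Rn \<omega> bs + d < Rn \<omega> (\<lambda>j. bs j + v j)"
    using emp_risk_near[OF dev A(1,2) v(1) eq_refl[OF v(2)]] d by simp
qed (use emp_risk_convex[OF \<omega>] r d v in \<open>auto simp: L2_set_right_distrib\<close>)

text \<open>The deterministic core, for one favourable sample. The Lasso path contains the true
  support and models nested with it. A larger model improves the fit by less than one unit of
  penalty, and a smaller one loses more fit than the penalty can save.\<close>

lemma ss_run_selects:
  fixes k :: nat and lam a r1 d :: real
  assumes \<omega>: "\<omega> \<in> space M" and bs: "supp bs \<subseteq> {1..p}" and card: "card (supp bs) \<le> k"
    and run: "ss_run \<rho> p n (\<lambda>i. Xs i \<omega>) (\<lambda>i. Ys i \<omega>) lam a bL js bhat shat"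
    and a: "a > 0" and r1: "r1 \<ge> 0"
    and lasso: "\<And>v. supp v \<subseteq> {1..p} \<Longrightarrow> l1 v {1..p} \<ge> r1 \<Longrightarrow>
        Rn \<omega> (\<lambda>j. bs j + v j) + lam * l1 (\<lambda>j. bs j + v j) {1..p} > Rn \<omega> bs + lam * l1 bs {1..p}"
    and sep: "\<And>j. j \<in> supp bs \<Longrightarrow> 2 * r1 \<le> \<bar>bs j\<bar>"
    and size: "\<And>w. w \<in> ss_models js \<Longrightarrow> card w \<le> k"
    and r2: "r2 \<ge> 0"
    and fit: "\<And>v. supp v \<subseteq> supp bs \<Longrightarrow> L2_set v {1..p} > r2 \<Longrightarrow> Rn \<omega> (\<lambda>j. bs j + v j) > Rn \<omega> bs"
    and over: "\<And>w b. w \<subseteq> {1..p} \<Longrightarrow> card w \<le> k \<Longrightarrow> supp bs \<subseteq> w \<Longrightarrow> supp b \<subseteq> w \<Longrightarrow>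
        Rn \<omega> b > Rn \<omega> bs - a / real n"
    and under: "\<And>w b. w \<subset> supp bs \<Longrightarrow> supp b \<subseteq> w \<Longrightarrow> Rn \<omega> b > Rn \<omega> bs + a * real k / real n"
  shows "shat = supp bs"
proof -
  let ?S = "supp bs" and ?G = "gic \<rho> p n (\<lambda>i. Xs i \<omega>) (\<lambda>i. Ys i \<omega>) a bhat"
  let ?Q = "\<lambda>b. Rn \<omega> b + lam * l1 b {1..p}"
  have finS: "finite ?S" using bs by (rule finite_subset) simp
  have choice_L: "arg_min_choice ?Q (\<lambda>b. supp b \<subseteq> {1..p}) bL"
    and js: "ordered_supp bL js"
    and choice_w: "\<And>w. w \<subseteq> {1..p} \<Longrightarrow> arg_min_choice (Rn \<omega>) (\<lambda>b. supp b \<subseteq> w) (bhat w)"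
    and shat: "is_arg_min ?G (\<lambda>w. w \<in> ss_models js) shat"
    using run by (auto simp: ss_run_def)
  have bL: "supp bL \<subseteq> {1..p}" using choice_L by (simp add: arg_min_choice_def)
  have plus: "(\<lambda>j. bs j + (b - bs) j) = b" for b :: "nat \<Rightarrow> real" by (simp add: fun_eq_iff)

  \<comment> \<open>The escape bound makes the Lasso objective coercive, so \<open>bL\<close> is a
    genuine minimizer and not a default value.\<close>
  have "continuous_on UNIV ?Q"
    unfolding l1_def using emp_risk_continuous[OF \<omega>] by (intro continuous_intros) auto
  then have "\<exists>y. is_arg_min ?Q (\<lambda>b. supp b \<subseteq> {1..p}) y"
  proof (rule ex_is_arg_min_coercive[OF _ bs r1])
    fix b j assume b: "supp b \<subseteq> {1..p}" "\<bar>b j - bs j\<bar> > r1"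
    have j: "j \<in> {1..p}"
    proof (rule ccontr)
      assume "j \<notin> {1..p}"
      then show False using b r1 zero_outside_supp[OF b(1)] zero_outside_supp[OF bs] by simp
    qed
    have "l1 (b - bs) {1..p} \<ge> r1" using abs_le_l1[of "{1..p}" j "b - bs"] j b by simp
    then show "?Q bs < ?Q b"
      using lasso[of "b - bs"] supp_diff[OF b(1) bs] by (simp add: plus del: minus_apply)
  qed
  then have le: "?Q bL \<le> ?Q bs" by (rule arg_min_choice_le[OF choice_L]) (rule bs)
  have l1: "l1 (bL - bs) {1..p} < r1"
  proof (rule ccontr)
    assume "\<not> ?thesis"
    then have "?Q bs < ?Q bL"
      using lasso[of "bL - bs"] supp_diff[OF bL bs] by (simp add: plus not_less del: minus_apply)
    with le show False by simp
  qed
  have close: "\<bar>bL j - bs j\<bar> < r1" for j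
  proof (cases "j \<in> {1..p}")
    case True
    then show ?thesis using l1 abs_le_l1[of "{1..p}" j "bL - bs"] by simp
  next
    case False
    have "0 \<le> l1 (bL - bs) {1..p}" by (simp add: l1_def sum_nonneg)
    then show ?thesis using l1 zero_outside_supp[OF bL False] zero_outside_supp[OF bs False] by simp
  qed
  \<comment> \<open>Every coefficient moves by less than \<open>r1\<close>, and true nonzero ones
    are at least \<open>2 * r1\<close>. The threshold \<open>r1\<close> therefore separates the
    support from its complement.\<close>
  have sep_models: "?S \<in> ss_models js" "\<And>w. w \<in> ss_models js \<Longrightarrow> w \<subseteq> ?S \<or> ?S \<subseteq> w"
  proof -
    have big: "r1 < \<bar>bL i\<bar>" if "i \<in> ?S" for i using sep[OF that] close[of i] by linarith
    have small: "\<bar>bL j\<bar> < r1" if "j \<notin> ?S" for j using that close[of j] by (simp add: supp_def)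
    show "?S \<in> ss_models js" "\<And>w. w \<in> ss_models js \<Longrightarrow> w \<subseteq> ?S \<or> ?S \<subseteq> w"
      using ss_models_separated[OF js finS big small r1] by blast+
  qed

  \<comment> \<open>Existence is established for the true model, whose fit must be bounded from
    above. The bounds for competing models hold for every vector supported in them, whatever value
    \<open>bhat\<close> takes there.\<close>
  have "\<exists>y. is_arg_min (Rn \<omega>) (\<lambda>b. supp b \<subseteq> ?S) y"
  proof (rule ex_is_arg_min_coercive[OF emp_risk_continuous[OF \<omega>] subset_refl r2])
    fix b j assume b: "supp b \<subseteq> ?S" "\<bar>b j - bs j\<bar> > r2"
    have j: "j \<in> {1..p}"
    proof (rule ccontr)
      assume "j \<notin> {1..p}"
      then show False
        using b r2 zero_outside_supp[OF order_trans[OF b(1) bs]] zero_outside_supp[OF bs] by simp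
    qed
    have "\<bar>(b - bs) j\<bar> \<le> L2_set (b - bs) {1..p}"
      using member_le_L2_set[of "{1..p}" j "\<lambda>j. \<bar>(b - bs) j\<bar>"] j by (simp add: L2_set_def)
    then show "Rn \<omega> bs < Rn \<omega> b"
      using fit[of "b - bs"] supp_diff[OF b(1) subset_refl] b by (simp add: plus)
  qed
  then have fitS: "Rn \<omega> (bhat ?S) \<le> Rn \<omega> bs" by (rule arg_min_choice_le[OF choice_w[OF bs]]) (rule subset_refl)
  have supp_hat: "supp (bhat w) \<subseteq> w" if "w \<subseteq> {1..p}" for w
    using choice_w[OF that] by (simp add: arg_min_choice_def)
  have n0: "real n > 0" using n by simp
  have better: "?G ?S < ?G w" if w: "w \<in> ss_models js" "w \<noteq> ?S" for w
  proof -
    have wp: "w \<subseteq> {1..p}" and finw: "finite w"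
    proof -
      have "w \<subseteq> set js" using w(1) by (auto simp: ss_models_def dest: in_set_takeD)
      then show "w \<subseteq> {1..p}" using js bL by (simp add: ordered_supp_def)
      then show "finite w" by (rule finite_subset) simp
    qed
    have nS: "real n * Rn \<omega> (bhat ?S) \<le> real n * Rn \<omega> bs" using fitS n0 by simp
    from sep_models(2)[OF w(1)] show ?thesis
    proof
      assume "w \<subseteq> ?S"
      then have sub: "w \<subset> ?S" using w(2) by auto
      have "Rn \<omega> (bhat w) > Rn \<omega> bs + a * real k / real n" by (rule under[OF sub supp_hat[OF wp]])
      then have "real n * Rn \<omega> (bhat w) > real n * (Rn \<omega> bs + a * real k / real n)" using n0 by simp
      then have "real n * Rn \<omega> (bhat w) > real n * Rn \<omega> bs + a * real k" using n0 by (simp add: distrib_left)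
      moreover have "a * real (card ?S) \<le> a * real k" "0 \<le> a * real (card w)" using a card by auto
      ultimately show ?thesis using nS by (simp add: gic_def)
    next
      assume sub: "?S \<subseteq> w"
      have "Rn \<omega> (bhat w) > Rn \<omega> bs - a / real n"
        by (rule over[OF wp size[OF w(1)] sub supp_hat[OF wp]])
      then have "real n * Rn \<omega> (bhat w) > real n * (Rn \<omega> bs - a / real n)" using n0 by simp
      then have "real n * Rn \<omega> (bhat w) > real n * Rn \<omega> bs - a" using n0 by (simp add: right_diff_distrib)
      \<comment> \<open>A strictly larger model has at least one more element, which costs at least
        one full unit \<open>a\<close>.\<close>
      moreover have "card ?S < card w" using sub w(2) finw by (intro psubset_card_mono) auto
      then have "real (card ?S) + 1 \<le> real (card w)" by simp
      then have "a * (real (card ?S) + 1) \<le> a * real (card w)" using a by (intro mult_left_mono) auto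
      ultimately show ?thesis using nS by (simp add: gic_def distrib_left)
    qed
  qed
  then show ?thesis using shat sep_models(1) by (auto simp: is_arg_min_def)
qed

text \<open>Three uniform deviation events, at the scales of the Lasso, of overfitting and of
  underfitting, together with the size bound on the path force correct selection. The failure
  probabilities are added.\<close>

lemma selection_probability:
  fixes k :: nat and lam a \<theta>a \<kappa>0 e \<delta> \<theta> \<epsilon> m :: real and H :: "nat \<Rightarrow> nat \<Rightarrow> real"
  assumes bs: "supp bs \<subseteq> {1..p}" and card: "card (supp bs) \<le> k" and k: "k \<ge> 1"
    and min: "\<And>b. supp b \<subseteq> {1..p} \<Longrightarrow> R bs \<le> R b"
    and run: "\<And>\<omega>. \<omega> \<in> space M \<Longrightarrow>
        ss_run \<rho> p n (\<lambda>i. Xs i \<omega>) (\<lambda>i. Ys i \<omega>) lam a (bL \<omega>) (js \<omega>) (bhat \<omega>) (shat \<omega>)"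
    and shat: "shat \<in> measurable M (count_space (Pow {1..p}))"
    and cond_a: "\<And>b. supp b \<subseteq> {1..p} \<Longrightarrow> b - bs \<in> cone_eps p (supp bs) e \<inter> l1_ball p \<delta> \<Longrightarrow>
        R b - R bs \<ge> \<theta>a / 2 * quad p H (b - bs)"
    and kap: "\<And>v. v \<in> cone_eps p (supp bs) e \<Longrightarrow> v \<noteq> (\<lambda>_. 0) \<Longrightarrow> \<kappa>0 * dotp p v v \<le> quad p H v"
    and cond_b: "\<And>w b. w \<subseteq> {1..p} \<Longrightarrow> card w \<le> k \<Longrightarrow> supp b \<subseteq> w \<Longrightarrow>
        L2_set (b - bs) {1..p} \<le> \<epsilon> \<Longrightarrow> R b - R bs \<ge> \<theta> * (L2_set (b - bs) {1..p})\<^sup>2"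
    and pos: "\<kappa>0 > 0" "\<theta>a > 0" "e > 0" "lam > 0" "a > 0" "\<theta> > 0" "\<epsilon> > 0" "m > 0"
    and m: "\<And>j. j \<in> supp bs \<Longrightarrow> m \<le> \<bar>bs j\<bar>" "m \<le> 1"
    and small_lam: "4 * real k * lam / (\<theta>a * \<kappa>0) \<le> \<delta>" "8 * real k * lam / (\<theta>a * \<kappa>0) \<le> m"
    and small_a: "a / (real n * \<theta>) \<le> \<epsilon>\<^sup>2" "a * real k / real n < \<theta> * ((min 1 \<epsilon>) * m)\<^sup>2 / 2"
    and size: "{\<omega> \<in> space M. \<forall>w\<in>ss_models (js \<omega>). card w \<le> k} \<in> sets M"
  shows "prob {\<omega> \<in> space M. shat \<omega> = supp bs}
     \<ge> prob {\<omega> \<in> space M. \<forall>w\<in>ss_models (js \<omega>). card w \<le> k}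
       - 4 * real p * exp (- real n * lam\<^sup>2 / (512 * L\<^sup>2 * s2))
       - 4 * real p * exp (- (a / real k) * (\<theta> / (128 * L\<^sup>2 * s2)))
       - 4 * real p * exp (- (real n * m\<^sup>2 / real k) * (\<theta>\<^sup>2 * (min 1 \<epsilon>)\<^sup>2 / (128 * L\<^sup>2 * s2)))"
    (is "_ \<ge> prob ?D - ?x1 - ?x2 - ?x3")
proof -
  let ?S = "supp bs"
  have n0: "real n > 0" and k0: "real k > 0" using n k by auto
  define r1 where "r1 = 4 * real k * lam / (\<theta>a * \<kappa>0)"
  have r1: "r1 > 0" using pos k0 by (simp add: r1_def)
  \<comment> \<open>Chosen so that the curvature gain \<open>\<theta> * r2\<^sup>2\<close> equals
    \<open>a / n\<close>, twice the deviation \<open>a / (2 * n)\<close> allowed at this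
    scale.\<close>
  define r2 where "r2 = sqrt (a / (real n * \<theta>))"
  have r2: "r2 > 0" "r2\<^sup>2 = a / (real n * \<theta>)" using pos n0 by (simp_all add: r2_def)
  have r2\<epsilon>: "r2 \<le> \<epsilon>" using small_a(1) less_imp_le[OF pos(7)] unfolding r2(2)[symmetric] by (rule power2_le_imp_le)
  \<comment> \<open>At most \<open>\<epsilon>\<close>, where the curvature is available, and at most
    \<open>m\<close>, the least distance between \<open>bs\<close> and a vector that misses a true
    coordinate.\<close>
  define r3 where "r3 = (min 1 \<epsilon>) * m"
  have r3: "r3 > 0" using pos by (simp add: r3_def)
  have r3m: "r3 \<le> m" and r3\<epsilon>: "r3 \<le> \<epsilon>"
  proof -
    have "r3 \<le> 1 * m" unfolding r3_def using pos by (intro mult_right_mono) auto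
    then show "r3 \<le> m" by simp
    have "r3 \<le> \<epsilon> * 1" unfolding r3_def using pos m by (intro mult_mono) auto
    then show "r3 \<le> \<epsilon>" by simp
  qed
  obtain E1 where E1: "E1 \<in> sets M" "prob E1 \<ge> 1 - 4 * real p * exp (- real n * (lam * r1 / 4)\<^sup>2 / (32 * L\<^sup>2 * r1\<^sup>2 * s2))"
    and dev1: "\<And>\<omega> v. \<omega> \<in> E1 \<Longrightarrow> l1 v {1..p} \<le> r1 \<Longrightarrow> \<bar>risk_deviation bs \<omega> v\<bar> \<le> lam * r1 / 4"
    using uniform_deviation[of r1 "lam * r1 / 4" bs] r1 pos by auto
  obtain E2 where E2: "E2 \<in> sets M" "prob E2 \<ge> 1 - 4 * real p * exp (- real n * (a / (2 * real n))\<^sup>2 / (32 * L\<^sup>2 * (sqrt (real k) * r2)\<^sup>2 * s2))"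
    and dev2: "\<And>\<omega> v. \<omega> \<in> E2 \<Longrightarrow> l1 v {1..p} \<le> sqrt (real k) * r2 \<Longrightarrow> \<bar>risk_deviation bs \<omega> v\<bar> \<le> a / (2 * real n)"
    using uniform_deviation[of "sqrt (real k) * r2" "a / (2 * real n)" bs] r2 k0 n0 pos by auto
  obtain E3 where E3: "E3 \<in> sets M" "prob E3 \<ge> 1 - 4 * real p * exp (- real n * (\<theta> * r3\<^sup>2 / 2)\<^sup>2 / (32 * L\<^sup>2 * (sqrt (real k) * r3)\<^sup>2 * s2))"
    and dev3: "\<And>\<omega> v. \<omega> \<in> E3 \<Longrightarrow> l1 v {1..p} \<le> sqrt (real k) * r3 \<Longrightarrow> \<bar>risk_deviation bs \<omega> v\<bar> \<le> \<theta> * r3\<^sup>2 / 2"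
    using uniform_deviation[of "sqrt (real k) * r3" "\<theta> * r3\<^sup>2 / 2" bs] r3 k0 pos by auto
  \<comment> \<open>Only the ratio of deviation to radius enters the exponents. Here it is
    \<open>lam / 4\<close>, so the radius cancels; at the other two scales the leading factors are
    \<open>a / k\<close> and \<open>n * m\<^sup>2 / k\<close>.\<close>
  have e1: "- real n * (lam * r1 / 4)\<^sup>2 / (32 * L\<^sup>2 * r1\<^sup>2 * s2) = - real n * lam\<^sup>2 / (512 * L\<^sup>2 * s2)"
    using r1 L s2 by (simp add: field_simps power2_eq_square)
  have e2: "- real n * (a / (2 * real n))\<^sup>2 / (32 * L\<^sup>2 * (sqrt (real k) * r2)\<^sup>2 * s2)
      = - (a / real k) * (\<theta> / (128 * L\<^sup>2 * s2))"
  proof -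
    have sq: "(sqrt (real k) * r2)\<^sup>2 = real k * (a / (real n * \<theta>))"
      using k0 by (simp add: power_mult_distrib r2(2))
    show ?thesis unfolding sq using n0 k0 L s2 pos(5,6) by (simp add: power2_eq_square field_simps)
  qed
  have e3: "- real n * (\<theta> * r3\<^sup>2 / 2)\<^sup>2 / (32 * L\<^sup>2 * (sqrt (real k) * r3)\<^sup>2 * s2)
      = - (real n * m\<^sup>2 / real k) * (\<theta>\<^sup>2 * (min 1 \<epsilon>)\<^sup>2 / (128 * L\<^sup>2 * s2))"
  proof -
    have "- real n * (\<theta> * r3\<^sup>2 / 2)\<^sup>2 / (32 * L\<^sup>2 * (sqrt (real k) * r3)\<^sup>2 * s2)
        = - (real n * r3\<^sup>2 / real k) * (\<theta>\<^sup>2 / (128 * L\<^sup>2 * s2))"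
      using k0 L s2 r3 by (simp add: power_mult_distrib) (simp add: field_simps power2_eq_square)
    then show ?thesis by (simp add: r3_def power_mult_distrib ac_simps)
  qed
  let ?T = "{\<omega> \<in> space M. shat \<omega> = ?S}"
  have "?T = shat -` {?S} \<inter> space M" by auto
  then have T: "?T \<in> sets M" using bs measurable_sets[OF shat, of "{?S}"] by auto
  have sub: "?D \<inter> E1 \<inter> E2 \<inter> E3 \<subseteq> ?T"
  proof
    fix \<omega> assume \<omega>: "\<omega> \<in> ?D \<inter> E1 \<inter> E2 \<inter> E3"
    then have sp: "\<omega> \<in> space M" by auto
    have half: "a / (2 * real n) < a / real n" using pos n0 by (simp add: field_simps)
    have l2: "Rn \<omega> (\<lambda>j. bs j + v j) > Rn \<omega> bs"
      if "w \<subseteq> {1..p}" "card w \<le> k" "?S \<subseteq> w" "supp v \<subseteq> w" "L2_set v {1..p} \<ge> r2" for w v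
      using emp_risk_escape[OF sp dev2 that(1-3) cond_b[OF that(1,2)] r2(1) r2\<epsilon> _ _ that(4,5), of 0] \<omega> r2(2) n0 pos half
      by simp
    have "shat \<omega> = ?S"
    proof (rule ss_run_selects[OF sp bs card run[OF sp]])
      show "Rn \<omega> bs + lam * l1 bs {1..p} < Rn \<omega> (\<lambda>j. bs j + v j) + lam * l1 (\<lambda>j. bs j + v j) {1..p}"
        if "supp v \<subseteq> {1..p}" "r1 \<le> l1 v {1..p}" for v
        using lasso_objective_escape[OF sp bs card k min cond_a kap pos(1-4) r1_def small_lam(1)[folded r1_def] dev1 that] \<omega>
        by simp
      show "2 * r1 \<le> \<bar>bs j\<bar>" if "j \<in> ?S" for j
        using m(1)[OF that] small_lam(2) by (simp add: r1_def)
      show "card w \<le> k" if "w \<in> ss_models (js \<omega>)" for w using \<omega> that by auto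
      show "Rn \<omega> bs < Rn \<omega> (\<lambda>j. bs j + v j)" if "supp v \<subseteq> ?S" "r2 < L2_set v {1..p}" for v
        using l2[OF bs card subset_refl that(1)] that(2) by simp
      show "Rn \<omega> bs - a / real n < Rn \<omega> b"
        if w: "w \<subseteq> {1..p}" "card w \<le> k" "?S \<subseteq> w" "supp b \<subseteq> w" for w b
      proof -
        have eq: "(\<lambda>j. bs j + (b - bs) j) = b" by (simp add: fun_eq_iff)
        have sv: "supp (b - bs) \<subseteq> w" by (rule supp_diff[OF w(4,3)])
        show ?thesis
        proof (cases "L2_set (b - bs) {1..p} \<ge> r2")
          case True
          then have "Rn \<omega> bs < Rn \<omega> b" using l2[OF w(1-3) sv] by (simp only: eq)
          moreover have "a / real n > 0" using pos n0 by simp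
          ultimately show ?thesis by linarith
        next
          case False
          \<comment> \<open>Inside the sphere minimality of the risk at \<open>bs\<close> suffices:
            the fit can improve only by the deviation \<open>a / (2 * n)\<close>, half of the
            permitted amount.\<close>
          have "Rn \<omega> b - Rn \<omega> bs \<ge> (R b - R bs) - a / (2 * real n)"
            using emp_risk_near[OF dev2 w(1,2) sv] \<omega> False unfolding eq by simp
          moreover have "R b \<ge> R bs" using w by (intro min) auto
          ultimately show ?thesis using half by linarith
        qed
      qed
      show "Rn \<omega> bs + a * real k / real n < Rn \<omega> b" if w: "w \<subset> ?S" "supp b \<subseteq> w" for w b
      proof -
        have eq: "(\<lambda>j. bs j + (b - bs) j) = b" by (simp add: fun_eq_iff)
        have sv: "supp (b - bs) \<subseteq> ?S" using w by (intro supp_diff) auto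
        obtain j where j: "j \<in> ?S" "j \<notin> w" using w by auto
        \<comment> \<open>At a missed true coordinate the difference is the whole coefficient, so
          \<open>b\<close> lies outside the sphere of radius \<open>r3\<close>.\<close>
        have "m \<le> \<bar>(b - bs) j\<bar>" using m(1)[OF j(1)] zero_outside_supp[OF w(2) j(2)] by simp
        also have "\<dots> \<le> L2_set (b - bs) {1..p}"
          using member_le_L2_set[of "{1..p}" j "\<lambda>j. \<bar>(b - bs) j\<bar>"] j bs by (auto simp: L2_set_def)
        finally have "r3 \<le> L2_set (b - bs) {1..p}" using r3m by simp
        then have "Rn \<omega> bs + a * real k / real n < Rn \<omega> (\<lambda>j. bs j + (b - bs) j)"
          using emp_risk_escape[OF sp dev3 bs card subset_refl cond_b[OF bs card] r3 r3\<epsilon> _ _ sv, of "a * real k / real n"]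
            \<omega> small_a(2) pos n0 k0 by (simp add: r3_def)
        then show ?thesis by (simp only: eq)
      qed
    qed (use pos r1 r2 in auto)
    with sp show "\<omega> \<in> ?T" by simp
  qed
  have inter: "prob (A \<inter> B) \<ge> prob A - x" if "A \<in> sets M" "B \<in> sets M" "prob B \<ge> 1 - x" for A B x
  proof -
    have "prob A = prob (A \<inter> B) + prob (A - B)"
      using that by (subst finite_measure_Union[symmetric]) (auto intro!: arg_cong[of _ _ prob])
    moreover have "prob (A - B) \<le> prob (space M - B)"
      using that sets.sets_into_space[OF that(1)] by (intro finite_measure_mono) auto
    ultimately show ?thesis using prob_compl[OF that(2)] that(3) by linarith
  qed
  have "prob ?D - ?x1 \<le> prob (?D \<inter> E1)" using inter[OF size E1] unfolding e1 .
  moreover have "prob (?D \<inter> E1) - ?x2 \<le> prob (?D \<inter> E1 \<inter> E2)"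
    using inter[OF _ E2, of "?D \<inter> E1"] size E1(1) unfolding e2 by blast
  moreover have "prob (?D \<inter> E1 \<inter> E2) - ?x3 \<le> prob (?D \<inter> E1 \<inter> E2 \<inter> E3)"
    using inter[OF _ E3, of "?D \<inter> E1 \<inter> E2"] size E1(1) E2(1) unfolding e3 by blast
  moreover have "prob (?D \<inter> E1 \<inter> E2 \<inter> E3) \<le> prob ?T"
    by (rule finite_measure_mono[OF sub T])
  ultimately show ?thesis by linarith
qed

end

section \<open>Asymptotics\<close>

text \<open>With \<open>l\<close> the logarithm of \<open>max p 2\<close>, the factor
  \<open>p\<close> is at most \<open>exp l\<close>, while \<open>l = o(E)\<close> makes the exponent
  exceed any multiple of \<open>l\<close>. The maximum with 2 keeps \<open>l\<close> at least
  \<open>ln 2\<close>, so the argument also covers bounded \<open>p\<close>.\<close>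

lemma exp_tail_vanishes:
  fixes E :: "nat \<Rightarrow> real" and p :: "nat \<Rightarrow> nat"
  assumes o: "(\<lambda>n. ln (max (real (p n)) 2)) \<in> o(E)" and E: "\<And>n. n \<ge> 1 \<Longrightarrow> E n \<ge> 0" and c: "c > 0"
  shows "(\<lambda>n. 4 * real (p n) * exp (- E n * c)) \<longlonglongrightarrow> 0"
proof (rule tendstoI)
  fix \<eta> :: real assume \<eta>: "\<eta> > 0"
  \<comment> \<open>Since \<open>l\<close> need not diverge, \<open>K\<close> depends on
    \<open>\<eta>\<close>: it gives \<open>4 * exp (- K * ln 2) < \<eta>\<close>. One extra copy of
    \<open>l\<close> in the exponent pays for the factor \<open>p\<close>.\<close>
  define K where "K = \<bar>ln (4 / \<eta>)\<bar> / ln 2 + 1"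
  have K: "K > 0" by (simp add: K_def add_nonneg_pos)
  have "ln (4 / \<eta>) < K * ln 2" by (simp add: K_def distrib_right) (smt (verit) ln_gt_zero)
  then have "exp (ln (4 / \<eta>)) < exp (K * ln 2)" by simp
  then have \<eta>K: "4 * exp (- K * ln 2) < \<eta>" using \<eta> by (simp add: exp_minus field_simps)
  have "eventually (\<lambda>n. norm (ln (max (real (p n)) 2)) \<le> c / (K + 1) * norm (E n)) sequentially"
    by (rule landau_o.smallD[OF o]) (use c K in auto)
  then show "eventually (\<lambda>n. dist (4 * real (p n) * exp (- E n * c)) 0 < \<eta>) sequentially"
    using eventually_ge_at_top[of 1]
  proof eventually_elim
    case (elim n)
    define l where "l = ln (max (real (p n)) 2)"
    have l2: "ln 2 \<le> l" unfolding l_def by simp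
    then have l0: "l \<ge> 0" using ln_gt_zero[of "2::real"] by linarith
    have "l \<le> c / (K + 1) * E n" using elim E[of n] l0 by (simp add: l_def)
    then have lE: "(K + 1) * l \<le> E n * c" using K by (simp add: field_simps)
    have "real (p n) \<le> exp l" by (simp add: l_def)
    then have "4 * real (p n) * exp (- E n * c) \<le> 4 * exp l * exp (- ((K + 1) * l))"
      using lE by (intro mult_mono) auto
    also have "\<dots> = 4 * exp (- K * l)" by (simp add: algebra_simps flip: exp_add)
    also have "\<dots> \<le> 4 * exp (- K * ln 2)" using K l2 by simp
    finally show ?case using \<eta>K by (simp add: dist_real_def)
  qed
qed

section \<open>Passage to the limit in the selection probability\<close>

theorem corollary5:
  fixes M :: "nat \<Rightarrow> 'a measure"
    and p k :: "nat \<Rightarrow> nat"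
    and X :: "nat \<Rightarrow> 'a \<Rightarrow> nat \<Rightarrow> real" and Y :: "nat \<Rightarrow> 'a \<Rightarrow> nat"
    and Xs :: "nat \<Rightarrow> nat \<Rightarrow> 'a \<Rightarrow> nat \<Rightarrow> real" and Ys :: "nat \<Rightarrow> nat \<Rightarrow> 'a \<Rightarrow> nat"
    and \<sigma> :: "nat \<Rightarrow> nat \<Rightarrow> real"
    and \<beta> \<beta>star u0 u :: "nat \<Rightarrow> nat \<Rightarrow> real" and q :: "nat \<Rightarrow> real \<Rightarrow> real"
    and \<rho> :: "real \<Rightarrow> nat \<Rightarrow> real" and L :: real
    and H :: "nat \<Rightarrow> nat \<Rightarrow> nat \<Rightarrow> real"
    and \<theta>a \<delta> \<epsilon>a \<theta> \<epsilon> :: real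
    and lam a :: "nat \<Rightarrow> real"
    and bL :: "nat \<Rightarrow> 'a \<Rightarrow> nat \<Rightarrow> real" and js :: "nat \<Rightarrow> 'a \<Rightarrow> nat list"
    and bhat :: "nat \<Rightarrow> 'a \<Rightarrow> nat set \<Rightarrow> nat \<Rightarrow> real" and shat :: "nat \<Rightarrow> 'a \<Rightarrow> nat set"
  assumes prob: "\<And>n. n \<ge> 1 \<Longrightarrow> prob_space (M n)"
    and obs: "\<And>n. n \<ge> 1 \<Longrightarrow> (\<lambda>\<omega>. (X n \<omega>, Y n \<omega>)) \<in> measurable (M n) (obs_space (p n))"
    and iid: "\<And>n. n \<ge> 1 \<Longrightarrow> iid_copies (M n) (p n) n (X n) (Y n) (Xs n) (Ys n)"
    and sigma_nonneg: "\<And>n j. n \<ge> 1 \<Longrightarrow> j \<in> {1..p n} \<Longrightarrow> \<sigma> n j \<ge> 0"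
    and subgaussian: "\<And>n i j. n \<ge> 1 \<Longrightarrow> i \<in> {1..n} \<Longrightarrow> j \<in> {1..p n} \<Longrightarrow>
          subg (M n) ((\<sigma> n j)\<^sup>2) (\<lambda>\<omega>. Xs n i \<omega> j)"
    and sigma_bounded: "limsup (\<lambda>n. ereal ((Max (\<sigma> n ` {1..p n}))\<^sup>2)) < \<infinity>"
    and nondegenerate: "\<And>n b. n \<ge> 1 \<Longrightarrow> supp b \<subseteq> {1..p n} \<Longrightarrow> b \<noteq> (\<lambda>_. 0) \<Longrightarrow>
          \<not> (\<exists>c. AE \<omega> in M n. dotp (p n) b (X n \<omega>) = c)"
    and beta: "\<And>n. n \<ge> 1 \<Longrightarrow> supp (\<beta> n) \<subseteq> {1..p n}"
    and q_measurable: "\<And>n. n \<ge> 1 \<Longrightarrow> q n \<in> borel_measurable borel"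
    and model: "\<And>n. n \<ge> 1 \<Longrightarrow> semiparametric_model (M n) (p n) (X n) (Y n) (\<beta> n) (q n)"
    and lrc: "\<And>n. n \<ge> 1 \<Longrightarrow> linear_regressions (M n) (p n) (X n) (\<beta> n) (u0 n) (u n)"
    and L_pos: "L > 0"
    and convex: "\<And>y. y \<in> {0, 1} \<Longrightarrow> convex_on UNIV (\<lambda>t. \<rho> t y)"
    and lipschitz: "\<And>y. y \<in> {0, 1} \<Longrightarrow> L-lipschitz_on UNIV (\<lambda>t. \<rho> t y)"
    and beta_star: "\<And>n. n \<ge> 1 \<Longrightarrow>
          is_arg_min (risk \<rho> (M n) (p n) (X n) (Y n)) (\<lambda>b. supp b \<subseteq> {1..p n}) (\<beta>star n)"
    and beta_star_unique: "\<And>n b. n \<ge> 1 \<Longrightarrow>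
          is_arg_min (risk \<rho> (M n) (p n) (X n) (Y n)) (\<lambda>b. supp b \<subseteq> {1..p n}) b \<Longrightarrow> b = \<beta>star n"
    and beta_star_nonzero: "\<And>n. n \<ge> 1 \<Longrightarrow> \<beta>star n \<noteq> (\<lambda>_. 0)"
    and k_pos: "\<And>n. n \<ge> 1 \<Longrightarrow> k n \<ge> 1"
    and lam_pos: "\<And>n. n \<ge> 1 \<Longrightarrow> lam n > 0"
    and a_pos: "\<And>n. n \<ge> 1 \<Longrightarrow> a n > 0"
    and constants: "\<theta>a > 0" "\<delta> > 0" "\<epsilon>a > 0" "\<theta> > 0" "\<epsilon> > 0"
    and H_nonneg: "\<And>n v. n \<ge> 1 \<Longrightarrow> supp v \<subseteq> {1..p n} \<Longrightarrow> quad (p n) (H n) v \<ge> 0"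
    and cond_a: "\<And>n b. n \<ge> 1 \<Longrightarrow> supp b \<subseteq> {1..p n} \<Longrightarrow>
          b - \<beta>star n \<in> cone_eps (p n) (supp (\<beta>star n)) \<epsilon>a \<inter> l1_ball (p n) \<delta> \<Longrightarrow>
          risk \<rho> (M n) (p n) (X n) (Y n) b - risk \<rho> (M n) (p n) (X n) (Y n) (\<beta>star n)
            \<ge> \<theta>a / 2 * quad (p n) (H n) (b - \<beta>star n)"
    and cond_b: "\<And>n w b. n \<ge> 1 \<Longrightarrow> w \<subseteq> {1..p n} \<Longrightarrow> card w \<le> k n \<Longrightarrow> supp b \<subseteq> w \<Longrightarrow>
          L2_set (b - \<beta>star n) {1..p n} \<le> \<epsilon> \<Longrightarrow>
          risk \<rho> (M n) (p n) (X n) (Y n) b - risk \<rho> (M n) (p n) (X n) (Y n) (\<beta>star n)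
            \<ge> \<theta> * (L2_set (b - \<beta>star n) {1..p n})\<^sup>2"
    and cond_c: "\<And>n. n \<ge> 1 \<Longrightarrow> card (supp (\<beta>star n)) \<le> k n"
    and ss: "\<And>n \<omega>. n \<ge> 1 \<Longrightarrow> \<omega> \<in> space (M n) \<Longrightarrow>
          ss_run \<rho> (p n) n (\<lambda>i. Xs n i \<omega>) (\<lambda>i. Ys n i \<omega>) (lam n) (a n)
            (bL n \<omega>) (js n \<omega>) (bhat n \<omega>) (shat n \<omega>)"
    and shat_measurable: "\<And>n. n \<ge> 1 \<Longrightarrow> shat n \<in> measurable (M n) (count_space (Pow {1..p n}))"
    and cond_d: "(\<lambda>n. measure (M n) {\<omega> \<in> space (M n). \<forall>w \<in> ss_models (js n \<omega>). card w \<le> k n})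
          \<longlonglongrightarrow> 1"
    and cond_e: "liminf (\<lambda>n. kappa (p n) (H n) (supp (\<beta>star n)) \<epsilon>a) > 0"
    and cond_f: "(\<lambda>n. ln (max (real (p n)) 2)) \<in> o(\<lambda>n. real n * (lam n)\<^sup>2)"
    and cond_g: "(\<lambda>n. real (k n) * lam n) \<in> o(\<lambda>n. min_coef1 (\<beta>star n))"
    and cond_h: "(\<lambda>n. real (k n) * ln (max (real (p n)) 2)) \<in> o(\<lambda>n. real n)"
    and cond_i: "(\<lambda>n. real (k n) * ln (max (real (p n)) 2)) \<in> o(a)"
    and cond_j: "(\<lambda>n. a n * real (k n)) \<in> o(\<lambda>n. real n * (min_coef1 (\<beta>star n))\<^sup>2)"
  shows "(\<lambda>n. measure (M n) {\<omega> \<in> space (M n). shat n \<omega> = supp (\<beta> n)}) \<longlonglongrightarrow> 1"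
proof -
  let ?\<Phi> = "\<lambda>n. risk \<rho> (M n) (p n) (X n) (Y n)"
  define l where "l n = ln (max (real (p n)) 2)" for n
  define m where "m n = min_coef1 (\<beta>star n)" for n
  have l0: "l n > 0" for n unfolding l_def by simp
  have bs: "supp (\<beta>star n) \<subseteq> {1..p n}" if "n \<ge> 1" for n
    using beta_star[OF that] by (simp add: is_arg_min_def)
  have min: "?\<Phi> n (\<beta>star n) \<le> ?\<Phi> n b" if "n \<ge> 1" "supp b \<subseteq> {1..p n}" for n b
    using beta_star[OF that(1)] that(2) by (auto simp: is_arg_min_def not_less)
  have m: "m n > 0" "m n \<le> 1" "\<And>j. j \<in> supp (\<beta>star n) \<Longrightarrow> m n \<le> \<bar>\<beta>star n j\<bar>" if "n \<ge> 1" for n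
    using min_coef1_supp[OF finite_subset[OF bs[OF that]] beta_star_nonzero[OF that]] by (auto simp: m_def)
  \<comment> \<open>A nonzero minimizer needs at least one coordinate.\<close>
  have p1: "p n \<ge> 1" if "n \<ge> 1" for n
  proof (rule ccontr)
    assume "\<not> p n \<ge> 1"
    then have "supp (\<beta>star n) = {}" using bs[OF that] by auto
    then show False using beta_star_nonzero[OF that] by (auto simp: supp_def)
  qed
  have k1: "real (k n) \<ge> 1" if "n \<ge> 1" for n using k_pos[OF that] by simp

  \<comment> \<open>A finite limsup yields a common variance proxy from some index on; the maximum
    with 1 makes it positive.\<close>
  obtain s2 where s2: "s2 > 0" "eventually (\<lambda>n. (Max (\<sigma> n ` {1..p n}))\<^sup>2 \<le> s2) sequentially"
  proof -
    obtain B where B: "limsup (\<lambda>n. ereal ((Max (\<sigma> n ` {1..p n}))\<^sup>2)) < ereal B"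
      using ereal_dense2[OF sigma_bounded] by auto
    have "eventually (\<lambda>n. ereal ((Max (\<sigma> n ` {1..p n}))\<^sup>2) < ereal B) sequentially"
      by (rule Limsup_lessD[OF B])
    then have "eventually (\<lambda>n. (Max (\<sigma> n ` {1..p n}))\<^sup>2 \<le> max B 1) sequentially"
      by eventually_elim auto
    then show thesis by (intro that[of "max B 1"]) auto
  qed
  \<comment> \<open>A finite real is taken strictly between 0 and the liminf, since the restricted
    eigenvalue itself may be infinite.\<close>
  obtain \<kappa>0 where \<kappa>0: "\<kappa>0 > 0"
    "eventually (\<lambda>n. ereal \<kappa>0 < kappa (p n) (H n) (supp (\<beta>star n)) \<epsilon>a) sequentially"
  proof -
    obtain \<kappa>0 where "0 < ereal \<kappa>0" "ereal \<kappa>0 < liminf (\<lambda>n. kappa (p n) (H n) (supp (\<beta>star n)) \<epsilon>a)"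
      using ereal_dense2[OF cond_e] by auto
    then show thesis using less_LiminfD by (intro that[of \<kappa>0]) auto
  qed

  let ?c1 = "1 / (512 * L\<^sup>2 * s2)" and ?c2 = "\<theta> / (128 * L\<^sup>2 * s2)"
    and ?c3 = "\<theta>\<^sup>2 * (min 1 \<epsilon>)\<^sup>2 / (128 * L\<^sup>2 * s2)"
  have c: "?c1 > 0" "?c2 > 0" "?c3 > 0" using s2(1) L_pos constants by auto
  have ev_g: "eventually (\<lambda>n. real (k n) * lam n \<le> x * m n) sequentially" if x: "x > 0" for x
    using landau_o.smallD[OF cond_g x] eventually_ge_at_top[of 1]
  proof eventually_elim
    case (elim n)
    then show ?case using m(1)[of n] lam_pos[of n] by (simp add: m_def abs_mult)
  qed
  have ev_i: "eventually (\<lambda>n. real (k n) * l n \<le> x * a n) sequentially" if x: "x > 0" for x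
    using landau_o.smallD[OF cond_i x] eventually_ge_at_top[of 1]
  proof eventually_elim
    case (elim n)
    then show ?case using l0[of n] a_pos[of n] by (simp add: l_def abs_mult)
  qed
  have ev_j: "eventually (\<lambda>n. a n * real (k n) \<le> x * (real n * (m n)\<^sup>2)) sequentially" if x: "x > 0" for x
    using landau_o.smallD[OF cond_j x] eventually_ge_at_top[of 1]
  proof eventually_elim
    case (elim n)
    then show ?case using a_pos[of n] by (simp add: m_def abs_mult)
  qed

  have tail1: "(\<lambda>n. 4 * real (p n) * exp (- (real n * (lam n)\<^sup>2) * ?c1)) \<longlonglongrightarrow> 0"
    by (rule exp_tail_vanishes[OF cond_f _ c(1)]) simp
  have tail2: "(\<lambda>n. 4 * real (p n) * exp (- (a n / real (k n)) * ?c2)) \<longlonglongrightarrow> 0"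
  proof (rule exp_tail_vanishes[OF landau_o.smallI _ c(2)])
    fix x :: real assume "x > 0"
    from ev_i[OF this] eventually_ge_at_top[of 1]
    show "eventually (\<lambda>n. norm (ln (max (real (p n)) 2)) \<le> x * norm (a n / real (k n))) sequentially"
    proof eventually_elim
      case (elim n)
      then show ?case using l0[of n] a_pos[of n] k1[of n] unfolding l_def[symmetric] by (simp add: field_simps)
    qed
  qed (simp add: a_pos less_imp_le)
  have tail3: "(\<lambda>n. 4 * real (p n) * exp (- (real n * (m n)\<^sup>2 / real (k n)) * ?c3)) \<longlonglongrightarrow> 0"
  proof (rule exp_tail_vanishes[OF landau_o.smallI _ c(3)])
    fix x :: real assume "x > 0"
    from ev_j[OF this] ev_i[OF zero_less_one] eventually_ge_at_top[of 1]
    show "eventually (\<lambda>n. norm (ln (max (real (p n)) 2)) \<le> x * norm (real n * (m n)\<^sup>2 / real (k n))) sequentially"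
    proof eventually_elim
      case (elim n)
      \<comment> \<open>Conditions (i) and (j) are chained:
        \<open>k * l \<le> a \<le> a * k \<le> x * n * m\<^sup>2\<close>, so
        \<open>n * m\<^sup>2 / k\<close> dominates \<open>l\<close>.\<close>
      have "a n * 1 \<le> a n * real (k n)" using elim a_pos[of n] k1[of n] by (intro mult_left_mono) auto
      then have "real (k n) * l n \<le> x * (real n * (m n)\<^sup>2)" using elim by linarith
      then show ?case using l0[of n] k1[of n] elim unfolding l_def[symmetric] by (simp add: field_simps)
    qed
  qed auto

  let ?D = "\<lambda>n. {\<omega> \<in> space (M n). \<forall>w \<in> ss_models (js n \<omega>). card w \<le> k n}"
  let ?T = "\<lambda>n. {\<omega> \<in> space (M n). shat n \<omega> = supp (\<beta> n)}"
  let ?low = "\<lambda>n. measure (M n) (?D n)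
      - 4 * real (p n) * exp (- (real n * (lam n)\<^sup>2) * ?c1)
      - 4 * real (p n) * exp (- (a n / real (k n)) * ?c2)
      - 4 * real (p n) * exp (- (real n * (m n)\<^sup>2 / real (k n)) * ?c3)"
  have low: "?low \<longlonglongrightarrow> 1"
    using tendsto_diff[OF tendsto_diff[OF tendsto_diff[OF cond_d tail1] tail2] tail3] by simp
  have evD: "eventually (\<lambda>n. measure (M n) (?D n) > 0) sequentially"
    by (rule order_tendstoD(1)[OF cond_d]) simp
  \<comment> \<open>\<open>?x1\<close> puts the Lasso radius below \<open>\<delta>\<close> and twice
    it below the smallest coefficient. The quarter in \<open>?x2\<close> leaves room for the strict
    inequality with one half.\<close>
  let ?x1 = "\<theta>a * \<kappa>0 * min (\<delta> / 4) (1 / 8)" and ?x2 = "\<theta> * (min 1 \<epsilon>)\<^sup>2 / 4"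
  have x: "?x1 > 0" "?x2 > 0" using \<kappa>0(1) constants by auto
  have "eventually (\<lambda>n. ?low n \<le> measure (M n) (?T n)) sequentially"
    using evD s2(2) \<kappa>0(2) ev_g[OF x(1)] ev_j[OF x(2)] eventually_ge_at_top[of 1]
  proof eventually_elim
    case (elim n)
    note n1 = \<open>1 \<le> n\<close>
    interpret prob_space "M n" by (rule prob[OF n1])
    have subg: "subg (M n) s2 (\<lambda>\<omega>. Xs n i \<omega> j)" if "i \<in> {1..n}" "j \<in> {1..p n}" for i j
    proof (rule subg_mono[OF subgaussian[OF n1 that]])
      have "\<sigma> n j \<le> Max (\<sigma> n ` {1..p n})" using that by (intro Max_ge) auto
      then have "(\<sigma> n j)\<^sup>2 \<le> (Max (\<sigma> n ` {1..p n}))\<^sup>2" using sigma_nonneg[OF n1 that(2)] by (intro power_mono) auto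
      then show "(\<sigma> n j)\<^sup>2 \<le> s2" using elim by linarith
    qed
    interpret S: lipschitz_sample "M n" "p n" n "X n" "Y n" "Xs n" "Ys n" \<rho> L s2
      using obs[OF n1] iid[OF n1] n1 p1[OF n1] L_pos s2(1) convex lipschitz subg by unfold_locales
    have supp_eq: "supp (\<beta>star n) = supp (\<beta> n)"
      by (rule S.supp_risk_minimizer[OF lrc[OF n1] model[OF n1] q_measurable[OF n1] beta[OF n1]
            beta_star[OF n1] beta_star_unique[OF n1] beta_star_nonzero[OF n1]])
    \<comment> \<open>A non-measurable set would have measure 0.\<close>
    have D: "?D n \<in> sets (M n)"
      using elim(1) measure_notin_sets[of "?D n" "M n"] by (cases "?D n \<in> sets (M n)") auto
    have kap: "\<kappa>0 * dotp (p n) v v \<le> quad (p n) (H n) v"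
      if v: "v \<in> cone_eps (p n) (supp (\<beta>star n)) \<epsilon>a" "v \<noteq> (\<lambda>_. 0)" for v
    proof -
      have "kappa (p n) (H n) (supp (\<beta>star n)) \<epsilon>a \<le> ereal (quad (p n) (H n) v / dotp (p n) v v)"
        unfolding kappa_def using v by (intro INF_lower) auto
      then have "\<kappa>0 < quad (p n) (H n) v / dotp (p n) v v"
        using elim(3) by (simp flip: less_ereal.simps)
      moreover have "dotp (p n) v v > 0"
      proof -
        obtain j where j: "v j \<noteq> 0" using v(2) by auto
        then have "j \<in> {1..p n}" using v(1) by (auto simp: cone_eps_def supp_def)
        then show ?thesis unfolding dotp_def using j
          by (intro sum_pos2[of _ j]) (auto simp: zero_less_mult_iff linorder_neq_iff)
      qed
      ultimately show ?thesis by (simp add: pos_less_divide_eq less_imp_le)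
    qed
    have kn: "real (k n) * lam n \<le> \<theta>a * \<kappa>0 * (\<delta> / 4)" "real (k n) * lam n \<le> \<theta>a * \<kappa>0 * (m n / 8)"
    proof -
      have t: "\<theta>a * \<kappa>0 > 0" using constants \<kappa>0 by simp
      have h: "min (\<delta> / 4) (1 / 8) * m n \<le> \<delta> / 4 * 1" using m[OF n1] constants by (intro mult_mono) auto
      have h': "min (\<delta> / 4) (1 / 8) * m n \<le> 1 / 8 * m n" using m[OF n1] by (intro mult_right_mono) auto
      have "\<theta>a * \<kappa>0 * (min (\<delta> / 4) (1 / 8) * m n) \<le> \<theta>a * \<kappa>0 * (\<delta> / 4)"
        "\<theta>a * \<kappa>0 * (min (\<delta> / 4) (1 / 8) * m n) \<le> \<theta>a * \<kappa>0 * (m n / 8)"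
        using mult_left_mono[OF h less_imp_le[OF t]] mult_left_mono[OF h' less_imp_le[OF t]] by simp_all
      then show "real (k n) * lam n \<le> \<theta>a * \<kappa>0 * (\<delta> / 4)" "real (k n) * lam n \<le> \<theta>a * \<kappa>0 * (m n / 8)"
        using elim(4) by (simp_all add: mult.assoc)
    qed
    have small_lam: "4 * real (k n) * lam n / (\<theta>a * \<kappa>0) \<le> \<delta>" "8 * real (k n) * lam n / (\<theta>a * \<kappa>0) \<le> m n"
      using kn constants \<kappa>0(1) by (simp_all add: field_simps)
    have n0: "real n > 0" using n1 by simp
    have ak: "a n * real (k n) / real n \<le> \<theta> * ((min 1 \<epsilon>) * m n)\<^sup>2 / 4"
      using elim(5) n0 by (simp add: field_simps power_mult_distrib)
    have "\<theta> * ((min 1 \<epsilon>) * m n)\<^sup>2 > 0" using constants m(1)[OF n1] by simp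
    then have small_a2: "a n * real (k n) / real n < \<theta> * ((min 1 \<epsilon>) * m n)\<^sup>2 / 2" using ak by linarith
    have small_a1: "a n / (real n * \<theta>) \<le> \<epsilon>\<^sup>2"
    proof -
      have "((min 1 \<epsilon>) * m n)\<^sup>2 \<le> (\<epsilon> * 1)\<^sup>2"
        using constants m[OF n1] by (intro power_mono mult_mono) auto
      then have "\<theta> * ((min 1 \<epsilon>) * m n)\<^sup>2 \<le> \<theta> * \<epsilon>\<^sup>2" using constants by simp
      moreover have "\<theta> * \<epsilon>\<^sup>2 > 0" using constants by simp
      ultimately have "a n * real (k n) / real n \<le> \<theta> * \<epsilon>\<^sup>2" using ak by linarith
      moreover have "a n * 1 / real n \<le> a n * real (k n) / real n"
        using a_pos[OF n1] k1[OF n1] n0 by (intro divide_right_mono mult_left_mono) auto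
      ultimately have "a n / real n \<le> \<theta> * \<epsilon>\<^sup>2" by simp
      then show ?thesis using n0 constants by (simp add: field_simps)
    qed
    show ?case
      using S.selection_probability[OF bs[OF n1] cond_c[OF n1] k_pos[OF n1] min[OF n1] ss[OF n1]
          shat_measurable[OF n1] cond_a[OF n1] kap cond_b[OF n1] \<kappa>0(1) constants(1,3) lam_pos[OF n1]
          a_pos[OF n1] constants(4,5) m(1)[OF n1] m(3)[OF n1] m(2)[OF n1] small_lam small_a1 small_a2 D]
      by (simp add: supp_eq)
  qed
  moreover have "eventually (\<lambda>n. measure (M n) (?T n) \<le> 1) sequentially"
    using eventually_ge_at_top[of 1]
    by eventually_elim (use prob prob_space.prob_le_1 in blast)
  ultimately show ?thesis
    by (rule tendsto_sandwich[OF _ _ low tendsto_const])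
qed

end
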